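(* Let $k$ be an algebraically closed field of characteristic $0$ and let $n\ge 3$. Then: (1) for every $B\in\mathcal P_n$, the polynomial class $[B]$ is a $2$-dimensional subvariety of $\mathcal P_n$; (2) $\dim(\Sigma_n)=n-2$.
   Context: For $A,B\subseteq k$, $A\le_p B$ means that there is a polynomial $P\in k[X]$ with $A=P^{-1}(B)$; $A\equiv_p B$ means $A\le_p B$ and $B\le_p A$; $[A]$ is the $\equiv_p$-class of $A$, called a polynomial class. $\mathcal P_n$ is the set of $n$-element subsets of $k$, and $\Sigma_n=\{[A]\mid A\in\mathcal P_n\}$. Two elements of $\mathcal P_n$ are $\equiv_p$-equivalent if and only if one is the image of the other under a linear polynomial $cX+c'$ with $c\neq 0$. Variety structures: let $f_n=\prod_{j\ne j'}(X_j-X_{j'})\in k[X_1,\ldots,X_n]$ and let $D(f_n)\subseteq k^n$ be the open set of points with pairwise distinct coordinates, an affine variety with ring of regular functions $k[X_1,\ldots,X_n]_{f_n}$. $\mathcal P_n$ is the affine variety obtained as the geometric quotient of $D(f_n)$ by the symmetric group $Sym_n$ permuting coordinates, with projection $\theta(a_1,\ldots,a_n)=\{a_1,\ldots,a_n\}$; its regular functions are the $Sym_n$-invariant regular functions on $D(f_n)$. $\Sigma_n$ is the affine variety obtained as the geometric quotient of $\mathcal P_n$ by the action $(P,A)\mapsto P(A)$ of the group of linear polynomials (under composition), with projection $\theta'(A)=[A]$, the quotient topology, and regular functions those regular functions on $\mathcal P_n$ which are invariant under this action. A subvariety is a (possibly empty, possibly reducible) Zariski closed subset. *)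

theory Defs
  imports
    "HOL-Analysis.Abstract_Topology"
    "HOL-Library.Poly_Mapping"
    "HOL-Library.FuncSet"
    "HOL-Library.Extended_Real"
    "HOL-Computational_Algebra.Polynomial"
    "HOL-Combinatorics.Permutations"
begin

section \<open>Polynomial reducibility\<close>

definition poly_le :: "'a::comm_semiring_0 set \<Rightarrow> 'a set \<Rightarrow> bool"  (infix \<open>\<le>\<^sub>p\<close> 50)
  where "A \<le>\<^sub>p B \<longleftrightarrow> (\<exists>P :: 'a poly. A = poly P -` B)"

definition poly_equiv :: "'a::comm_semiring_0 set \<Rightarrow> 'a set \<Rightarrow> bool"  (infix \<open>\<equiv>\<^sub>p\<close> 50)
  where "A \<equiv>\<^sub>p B \<longleftrightarrow> A \<le>\<^sub>p B \<and> B \<le>\<^sub>p A"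

definition poly_class :: "'a::comm_semiring_0 set \<Rightarrow> 'a set set"
  where "poly_class A = {B. B \<equiv>\<^sub>p A}"

text \<open>The underlying sets of the varieties \<open>P\<^sub>n\<close> and \<open>\<Sigma>\<^sub>n\<close>.\<close>

definition nsets :: "nat \<Rightarrow> 'a set set"
  where "nsets n = {A. finite A \<and> card A = n}"

definition Sigma_set :: "nat \<Rightarrow> 'a::comm_semiring_0 set set set"
  where "Sigma_set n = poly_class ` nsets n"


section \<open>Multivariate polynomials\<close>

text \<open>Exponent vectors are finitely supported maps from variable indices to exponents;
  multiplication is the convolution product of \<^theory>\<open>HOL-Library.Poly_Mapping\<close>.\<close>

type_synonym 'a mpoly = "(nat \<Rightarrow>\<^sub>0 nat) \<Rightarrow>\<^sub>0 'a"

definition mvar :: "nat \<Rightarrow> 'a::comm_ring_1 mpoly"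
  where "mvar i = Poly_Mapping.single (Poly_Mapping.single i 1) 1"

text \<open>The ring \<open>k[X\<^sub>1, \<dots>, X\<^sub>n]\<close>.\<close>

definition mpolys :: "nat \<Rightarrow> 'a::comm_ring_1 mpoly set"
  where "mpolys n = {p. \<forall>m\<in>Poly_Mapping.keys p. Poly_Mapping.keys m \<subseteq> {1..n}}"

definition meval_monom :: "(nat \<Rightarrow> 'a::comm_ring_1) \<Rightarrow> (nat \<Rightarrow>\<^sub>0 nat) \<Rightarrow> 'a"
  where "meval_monom x m = (\<Prod>i\<in>Poly_Mapping.keys m. x i ^ Poly_Mapping.lookup m i)"

definition meval :: "'a::comm_ring_1 mpoly \<Rightarrow> (nat \<Rightarrow> 'a) \<Rightarrow> 'a"
  where "meval p x = (\<Sum>m\<in>Poly_Mapping.keys p. Poly_Mapping.lookup p m * meval_monom x m)"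

lemma meval_monom_superset:
  assumes "finite I" "Poly_Mapping.keys m \<subseteq> I"
  shows "meval_monom x m = (\<Prod>i\<in>I. x i ^ Poly_Mapping.lookup m i)"
  unfolding meval_monom_def
  by (rule prod.mono_neutral_left) (use assms in \<open>auto simp: in_keys_iff\<close>)

lemma meval_monom_add: "meval_monom x (m + m') = meval_monom x m * meval_monom x m'"
proof -
  let ?I = "Poly_Mapping.keys m \<union> Poly_Mapping.keys m'"
  have "Poly_Mapping.keys (m + m') \<subseteq> ?I"
    by (rule Poly_Mapping.keys_add)
  then show ?thesis
    by (simp add: meval_monom_superset[of ?I] lookup_add power_add prod.distrib)
qed

lemma meval_superset:
  assumes "finite M" "Poly_Mapping.keys p \<subseteq> M"
  shows "meval p x = (\<Sum>m\<in>M. Poly_Mapping.lookup p m * meval_monom x m)"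
  unfolding meval_def
  by (rule sum.mono_neutral_left) (use assms in \<open>auto simp: in_keys_iff\<close>)

lemma meval_add: "meval (p + q) x = meval p x + meval q x"
proof -
  let ?M = "Poly_Mapping.keys p \<union> Poly_Mapping.keys q"
  have "Poly_Mapping.keys (p + q) \<subseteq> ?M"
    by (rule Poly_Mapping.keys_add)
  then show ?thesis
    by (simp add: meval_superset[of ?M] lookup_add algebra_simps sum.distrib)
qed

lemma meval_zero [simp]: "meval 0 x = 0"
  by (simp add: meval_def)

lemma meval_sum: "meval (\<Sum>i\<in>I. f i) x = (\<Sum>i\<in>I. meval (f i) x)"
  by (induction I rule: infinite_finite_induct) (auto simp: meval_add)

lemma meval_single: "meval (Poly_Mapping.single m c) x = c * meval_monom x m"
  by (simp add: meval_def)

lemma mpoly_sum_monoms: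
  "(\<Sum>m\<in>Poly_Mapping.keys p. Poly_Mapping.single m (Poly_Mapping.lookup p m)) = p"
  by (rule poly_mapping_eqI)
     (auto simp: lookup_sum lookup_single when_def not_in_keys_iff_lookup_eq_zero)

lemma meval_mult: "meval (p * q) x = meval p x * meval q x"
proof -
  let ?s = "\<lambda>p. \<Sum>m\<in>Poly_Mapping.keys p. Poly_Mapping.single m (Poly_Mapping.lookup p m)"
  have "meval (?s p * ?s q) x = meval p x * meval q x"
    by (simp only: sum_product mult_single meval_sum meval_single meval_monom_add)
       (simp only: meval_def sum_product mult_ac)
  then show ?thesis
    by (simp only: mpoly_sum_monoms)
qed

lemma meval_one [simp]: "meval 1 x = 1"
  by (simp add: meval_def meval_monom_def lookup_one)

lemma meval_diff: "meval (p - q) x = meval p x - meval q x"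
  using meval_add[of "p - q" q x] by simp

lemma meval_prod: "meval (\<Prod>i\<in>I. f i) x = (\<Prod>i\<in>I. meval (f i) x)"
  by (induction I rule: infinite_finite_induct) (auto simp: meval_mult)

lemma meval_mvar [simp]: "meval (mvar i) x = x i"
  by (simp add: mvar_def meval_single meval_monom_def)

lemma mpolys_mult:
  assumes "p \<in> mpolys n" "q \<in> mpolys n"
  shows "p * q \<in> mpolys n"
proof -
  have "Poly_Mapping.keys m \<subseteq> {1..n}" if "m \<in> Poly_Mapping.keys (p * q)" for m
  proof -
    from that keys_mult[of p q] obtain a b
      where "m = a + b" "a \<in> Poly_Mapping.keys p" "b \<in> Poly_Mapping.keys q"
      by blast
    with assms Poly_Mapping.keys_add[of a b] show ?thesis
      unfolding mpolys_def by blast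
  qed
  then show ?thesis
    by (simp add: mpolys_def)
qed

lemma mpolys_one: "1 \<in> mpolys n"
  by (simp add: mpolys_def)


section \<open>Varieties\<close>

text \<open>A variety is recorded as its Zariski topology together with its regular functions.
  Regular functions are total functions in HOL: their values outside the variety are irrelevant.\<close>

record ('p, 'k) variety =
  zariski :: "'p topology"
  regular :: "('p \<Rightarrow> 'k) set"

definition subvariety :: "('p, 'k) variety \<Rightarrow> 'p set \<Rightarrow> bool"
  where "subvariety V Z \<longleftrightarrow> closedin (zariski V) Z"

definition irreducible_space :: "'p topology \<Rightarrow> bool"
  where "irreducible_space X \<longleftrightarrow> topspace X \<noteq> {} \<and>
    (\<forall>C D. closedin X C \<and> closedin X D \<and> C \<union> D = topspace X \<longrightarrow> C = topspace X \<or> D = topspace X)"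

definition irreducible_closedin :: "'p topology \<Rightarrow> 'p set \<Rightarrow> bool"
  where "irreducible_closedin X Z \<longleftrightarrow> closedin X Z \<and> irreducible_space (subtopology X Z)"

text \<open>Krull dimension: the supremum of the lengths \<open>d\<close> of chains
  \<open>Z\<^sub>0 \<subset> \<dots> \<subset> Z\<^sub>d\<close> of irreducible closed sets (so \<open>-\<infinity>\<close> for the empty space).\<close>

definition krull_dim :: "'p topology \<Rightarrow> ereal"
  where "krull_dim X = Sup {ereal (real d) | d. \<exists>Z :: nat \<Rightarrow> 'p set.
    (\<forall>i\<le>d. irreducible_closedin X (Z i)) \<and> (\<forall>i<d. Z i \<subset> Z (Suc i))}"

definition variety_dim :: "('p, 'k) variety \<Rightarrow> ereal"
  where "variety_dim V = krull_dim (zariski V)"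

definition subvariety_dim :: "('p, 'k) variety \<Rightarrow> 'p set \<Rightarrow> ereal"
  where "subvariety_dim V Z = krull_dim (subtopology (zariski V) Z)"


subsection \<open>Affine space and basic open sets\<close>

definition affine_points :: "nat \<Rightarrow> (nat \<Rightarrow> 'a) set"
  where "affine_points n = {1..n} \<rightarrow>\<^sub>E UNIV"

definition affine_zariski :: "nat \<Rightarrow> (nat \<Rightarrow> 'a::idom) topology"
  where "affine_zariski n = topology (\<lambda>U. \<exists>S\<subseteq>mpolys n.
    U = {x\<in>affine_points n. \<exists>p\<in>S. meval p x \<noteq> 0})"

lemma openin_affine_zariski:
  fixes U :: "(nat \<Rightarrow> 'a::idom) set"
  shows "openin (affine_zariski n) U \<longleftrightarrow>
    (\<exists>S\<subseteq>mpolys n. U = {x\<in>affine_points n. \<exists>p\<in>S. meval p x \<noteq> 0})"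
proof -
  let ?L = "\<lambda>U :: (nat \<Rightarrow> 'a) set. \<exists>S\<subseteq>mpolys n. U = {x\<in>affine_points n. \<exists>p\<in>S. meval p x \<noteq> 0}"
  have "istopology ?L"
    unfolding istopology_def
  proof (intro conjI allI impI)
    fix U V assume "?L U" "?L V"
    then obtain S T where S: "S \<subseteq> mpolys n" "U = {x\<in>affine_points n. \<exists>p\<in>S. meval p x \<noteq> 0}"
      and T: "T \<subseteq> mpolys n" "V = {x\<in>affine_points n. \<exists>p\<in>T. meval p x \<noteq> 0}"
      by blast
    let ?R = "(\<lambda>(p, q). p * q) ` (S \<times> T)"
    have "?R \<subseteq> mpolys n"
      using S(1) T(1) by (auto intro!: mpolys_mult)
    moreover have "U \<inter> V = {x\<in>affine_points n. \<exists>p\<in>?R. meval p x \<noteq> 0}"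
      unfolding S(2) T(2) by (auto simp: meval_mult)
    ultimately show "?L (U \<inter> V)"
      by blast
  next
    fix \<K> assume *: "\<forall>K\<in>\<K>. ?L K"
    let ?S = "{p\<in>mpolys n. {x\<in>affine_points n. meval p x \<noteq> 0} \<subseteq> \<Union>\<K>}"
    have "x \<in> affine_points n \<and> (\<exists>p\<in>?S. meval p x \<noteq> 0)" if x: "x \<in> K" and K: "K \<in> \<K>" for x K
    proof -
      from * K obtain S where S: "S \<subseteq> mpolys n" "K = {x\<in>affine_points n. \<exists>p\<in>S. meval p x \<noteq> 0}"
        by blast
      with x obtain p where p: "x \<in> affine_points n" "p \<in> S" "meval p x \<noteq> 0"
        by blast
      moreover have "{x\<in>affine_points n. meval p x \<noteq> 0} \<subseteq> K"
        using S(2) p(2) by blast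
      ultimately show ?thesis
        using S(1) K by blast
    qed
    then have "\<Union>\<K> = {x\<in>affine_points n. \<exists>p\<in>?S. meval p x \<noteq> 0}"
      by blast
    moreover have "?S \<subseteq> mpolys n"
      by blast
    ultimately show "?L (\<Union>\<K>)"
      by (intro exI[of _ ?S] conjI)
  qed
  then show ?thesis
    by (simp only: affine_zariski_def topology_inverse')
qed

lemma topspace_affine_zariski [simp]:
  "topspace (affine_zariski n :: (nat \<Rightarrow> 'a::idom) topology) = affine_points n"
proof -
  have "openin (affine_zariski n) (affine_points n :: (nat \<Rightarrow> 'a) set)"
    unfolding openin_affine_zariski by (rule exI[of _ "{1}"]) (auto simp: mpolys_one)
  moreover have "U \<subseteq> affine_points n" if "openin (affine_zariski n) U" for U :: "(nat \<Rightarrow> 'a) set"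
    using that unfolding openin_affine_zariski by auto
  ultimately show ?thesis
    by (simp add: openin_subset openin_topspace subset_antisym)
qed

lemma closedin_affine_zariski:
  fixes C :: "(nat \<Rightarrow> 'a::idom) set"
  shows "closedin (affine_zariski n) C \<longleftrightarrow>
    (\<exists>S\<subseteq>mpolys n. C = {x\<in>affine_points n. \<forall>p\<in>S. meval p x = 0})"
proof -
  have "closedin (affine_zariski n) C \<longleftrightarrow>
    (\<exists>S\<subseteq>mpolys n. C \<subseteq> affine_points n \<and> affine_points n - C = {x\<in>affine_points n. \<exists>p\<in>S. meval p x \<noteq> 0})"
    by (auto simp: closedin_def openin_affine_zariski)
  also have "\<dots> \<longleftrightarrow> (\<exists>S\<subseteq>mpolys n. C = {x\<in>affine_points n. \<forall>p\<in>S. meval p x = 0})"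
    by (intro ex_cong1 conj_cong refl) blast
  finally show ?thesis .
qed

definition basic_open :: "nat \<Rightarrow> 'a::idom mpoly \<Rightarrow> (nat \<Rightarrow> 'a) set"
  where "basic_open n f = {x\<in>affine_points n. meval f x \<noteq> 0}"

text \<open>\<open>D(f)\<close> with ring of regular functions \<open>k[X\<^sub>1, \<dots>, X\<^sub>n]\<^sub>f\<close>.\<close>

definition basic_open_variety :: "nat \<Rightarrow> 'a::field mpoly \<Rightarrow> (nat \<Rightarrow> 'a, 'a) variety"
  where "basic_open_variety n f =
    \<lparr>zariski = subtopology (affine_zariski n) (basic_open n f),
     regular = {g. \<exists>p\<in>mpolys n. \<exists>m. \<forall>x\<in>basic_open n f. g x = meval p x / meval f x ^ m}\<rparr>"


subsection \<open>Geometric quotients\<close>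

text \<open>Quotient of \<open>X\<close> along a map \<open>q\<close>, carried by the image of \<open>q\<close>.\<close>

definition quotient_topology :: "'p topology \<Rightarrow> ('p \<Rightarrow> 'q) \<Rightarrow> 'q topology"
  where "quotient_topology X q = topology (\<lambda>U. U \<subseteq> q ` topspace X \<and> openin X {x\<in>topspace X. q x \<in> U})"

lemma openin_quotient_topology:
  "openin (quotient_topology X q) U \<longleftrightarrow> U \<subseteq> q ` topspace X \<and> openin X {x\<in>topspace X. q x \<in> U}"
proof -
  have "istopology (\<lambda>U. U \<subseteq> q ` topspace X \<and> openin X {x\<in>topspace X. q x \<in> U})"
    unfolding istopology_def
  proof (intro conjI allI impI, goal_cases)
    case (2 S T)
    have "{x\<in>topspace X. q x \<in> S \<inter> T} = {x\<in>topspace X. q x \<in> S} \<inter> {x\<in>topspace X. q x \<in> T}"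
      by auto
    with 2 show ?case by auto
  next
    case (4 \<K>)
    have "{x\<in>topspace X. q x \<in> \<Union>\<K>} = (\<Union>K\<in>\<K>. {x\<in>topspace X. q x \<in> K})"
      by auto
    with 4 show ?case by auto
  qed auto
  then show ?thesis
    by (simp add: quotient_topology_def)
qed

lemma topspace_quotient_topology [simp]: "topspace (quotient_topology X q) = q ` topspace X"
proof -
  have "{x\<in>topspace X. q x \<in> q ` topspace X} = topspace X"
    by auto
  then have "openin (quotient_topology X q) (q ` topspace X)"
    by (simp add: openin_quotient_topology)
  moreover have "topspace (quotient_topology X q) \<subseteq> q ` topspace X"
    using openin_quotient_topology[of X q "topspace (quotient_topology X q)"] by simp
  ultimately show ?thesis
    by (simp add: openin_subset subset_antisym)
qed

lemma quotient_map_quotient_topology: "quotient_map X (quotient_topology X q) q"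
  by (simp add: quotient_map_def openin_quotient_topology)

text \<open>The geometric quotient of \<open>V\<close> by a group whose orbits are the fibres of the projection \<open>q\<close>:
  the regular functions are those which, pulled back along \<open>q\<close>, are regular on \<open>V\<close>, that is,
  the regular functions on \<open>V\<close> which are constant on orbits. The lemmas
  \<open>theta_eq_iff\<close> and \<open>poly_class_eq_iff\<close> below identify the orbits.\<close>

definition geometric_quotient :: "('p, 'k) variety \<Rightarrow> ('p \<Rightarrow> 'q) \<Rightarrow> ('q, 'k) variety"
  where "geometric_quotient V q =
    \<lparr>zariski = quotient_topology (zariski V) q, regular = {g. g \<circ> q \<in> regular V}\<rparr>"


section \<open>The varieties of finite sets and of polynomial classes\<close>

definition discrim :: "nat \<Rightarrow> 'a::comm_ring_1 mpoly"
  where "discrim n = (\<Prod>(i, j)\<in>{(i, j). i \<in> {1..n} \<and> j \<in> {1..n} \<and> i \<noteq> j}. mvar i - mvar j)"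

definition theta :: "nat \<Rightarrow> (nat \<Rightarrow> 'a) \<Rightarrow> 'a set"
  where "theta n a = a ` {1..n}"

definition P_variety :: "nat \<Rightarrow> ('a::field set, 'a) variety"
  where "P_variety n = geometric_quotient (basic_open_variety n (discrim n)) (theta n)"

definition Sigma_variety :: "nat \<Rightarrow> ('a::field set set, 'a) variety"
  where "Sigma_variety n = geometric_quotient (P_variety n) poly_class"

lemma basic_open_discrim:
  "basic_open n (discrim n :: 'a::idom mpoly) = {x\<in>affine_points n. inj_on x {1..n}}"
proof -
  let ?I = "{(i, j). i \<in> {1..n} \<and> j \<in> {1..n} \<and> i \<noteq> j}"
  have fin: "finite ?I"
    by (rule finite_subset[of _ "{1..n} \<times> {1..n}"]) auto
  have "meval (discrim n :: 'a mpoly) x = (\<Prod>(i, j)\<in>?I. x i - x j)" for x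
    by (simp only: discrim_def meval_prod case_prod_unfold meval_diff meval_mvar)
  then have "meval (discrim n :: 'a mpoly) x \<noteq> 0 \<longleftrightarrow> (\<forall>(i, j)\<in>?I. x i \<noteq> x j)" for x
    using prod_zero_iff[OF fin, of "\<lambda>(i, j). x i - x j"] by auto
  then have "meval (discrim n :: 'a mpoly) x \<noteq> 0 \<longleftrightarrow> inj_on x {1..n}" for x
    unfolding inj_on_def by blast
  then show ?thesis
    by (simp add: basic_open_def)
qed

lemma theta_image: "theta n ` basic_open n (discrim n :: 'a::idom mpoly) = nsets n"
proof (intro equalityI subsetI)
  fix A :: "'a set" assume "A \<in> nsets n"
  then have "finite A" "card A = n"
    by (auto simp: nsets_def)
  then obtain h where h: "bij_betw h {1..n} A"
    using finite_same_card_bij[of "{1..n}" A] by auto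
  let ?x = "restrict h {1..n}"
  have "?x \<in> basic_open n (discrim n)" "theta n ?x = A"
    using h by (auto simp: basic_open_discrim affine_points_def theta_def bij_betw_def)
  then show "A \<in> theta n ` basic_open n (discrim n)"
    by blast
qed (auto simp: basic_open_discrim theta_def nsets_def card_image)

lemma topspace_P_variety [simp]: "topspace (zariski (P_variety n)) = (nsets n :: 'a::field set set)"
proof -
  have "topspace (zariski (basic_open_variety n (discrim n :: 'a mpoly))) = basic_open n (discrim n)"
    by (auto simp: basic_open_variety_def basic_open_def)
  then show ?thesis
    by (simp add: P_variety_def geometric_quotient_def theta_image)
qed

lemma topspace_Sigma_variety [simp]:
  "topspace (zariski (Sigma_variety n)) = (Sigma_set n :: 'a::field set set set)"
  by (simp add: Sigma_variety_def geometric_quotient_def Sigma_set_def)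

lemma theta_eq_iff:
  fixes a b :: "nat \<Rightarrow> 'a::idom"
  assumes "a \<in> basic_open n (discrim n)" "b \<in> basic_open n (discrim n)"
  shows "theta n a = theta n b \<longleftrightarrow> (\<exists>\<sigma>. \<sigma> permutes {1..n} \<and> b = a \<circ> \<sigma>)"
proof
  assume "\<exists>\<sigma>. \<sigma> permutes {1..n} \<and> b = a \<circ> \<sigma>"
  then show "theta n a = theta n b"
    unfolding theta_def by (metis image_comp permutes_image)
next
  assume eq: "theta n a = theta n b"
  have inj: "inj_on a {1..n}" "inj_on b {1..n}"
    and ext: "a \<in> affine_points n" "b \<in> affine_points n"
    using assms by (auto simp: basic_open_discrim)
  define \<tau> where "\<tau> = the_inv_into {1..n} a \<circ> b"
  have "bij_betw b {1..n} (a ` {1..n})"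
    using inj eq by (simp add: bij_betw_def theta_def)
  moreover have "bij_betw (the_inv_into {1..n} a) (a ` {1..n}) {1..n}"
    using inj by (simp add: bij_betw_the_inv_into bij_betw_def inj_on_the_inv_into the_inv_into_onto)
  ultimately have bij: "bij_betw \<tau> {1..n} {1..n}"
    unfolding \<tau>_def by (rule bij_betw_trans)
  define \<sigma> where "\<sigma> i = (if i \<in> {1..n} then \<tau> i else i)" for i
  have "bij_betw \<sigma> {1..n} {1..n}"
    using bij by (subst bij_betw_cong[of _ _ \<tau>]) (auto simp: \<sigma>_def)
  then have perm: "\<sigma> permutes {1..n}"
    by (rule bij_imp_permutes) (simp add: \<sigma>_def del: atLeastAtMost_iff)
  have "b i = a (\<sigma> i)" for i
  proof (cases "i \<in> {1..n}")
    case True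
    then have "b i \<in> a ` {1..n}"
      using eq by (auto simp: theta_def)
    with inj(1) True show ?thesis
      by (simp add: \<sigma>_def \<tau>_def f_the_inv_into_f del: atLeastAtMost_iff)
  next
    case False
    then show ?thesis
      using ext by (auto simp: \<sigma>_def affine_points_def PiE_def extensional_def)
  qed
  then have "b = a \<circ> \<sigma>"
    by auto
  with perm show "\<exists>\<sigma>. \<sigma> permutes {1..n} \<and> b = a \<circ> \<sigma>"
    by blast
qed

lemma poly_le_refl: "A \<le>\<^sub>p (A :: 'a::comm_ring_1 set)"
  unfolding poly_le_def by (rule exI[of _ "[:0, 1:]"]) auto

lemma poly_le_trans: "A \<le>\<^sub>p B \<Longrightarrow> B \<le>\<^sub>p C \<Longrightarrow> A \<le>\<^sub>p (C :: 'a::comm_ring_1 set)"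
proof -
  assume "A \<le>\<^sub>p B" "B \<le>\<^sub>p C"
  then obtain P Q where "A = poly P -` B" "B = poly Q -` C"
    by (auto simp: poly_le_def)
  then have "A = poly (pcompose Q P) -` C"
    by (auto simp: poly_pcompose)
  then show ?thesis
    by (auto simp: poly_le_def)
qed

lemma poly_class_eq_iff_equiv: "poly_class A = poly_class B \<longleftrightarrow> B \<equiv>\<^sub>p (A :: 'a::comm_ring_1 set)"
proof
  assume "poly_class A = poly_class B"
  moreover have "B \<in> poly_class B"
    by (simp add: poly_class_def poly_equiv_def poly_le_refl)
  ultimately show "B \<equiv>\<^sub>p A"
    by (simp add: poly_class_def set_eq_iff)
qed (auto simp: poly_class_def poly_equiv_def intro: poly_le_trans)

lemma sum_order_fibre:
  fixes P :: "'a::alg_closed_field poly"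
  assumes "P \<noteq> 0"
  shows "(\<Sum>a | poly P a = 0. order a P) = Polynomial.degree P"
proof -
  obtain M where M: "size M = Polynomial.degree P"
      "P = smult (lead_coeff P) (\<Prod>x\<in>#M. [:- x, 1:])"
    using alg_closed_imp_factorization[OF assms] by metis
  have "proots P = proots (\<Prod>x\<in>#M. [:- x, 1:])"
    using assms by (subst M(2)) simp
  also have "\<dots> = M"
  proof (induction M)
    case (add x M)
    have "(\<Prod>x\<in>#M. [:- x, 1:]) \<noteq> 0"
      by (auto simp: prod_mset_zero_iff)
    then have "proots ([:- x, 1:] * (\<Prod>x\<in>#M. [:- x, 1:])) = {#x#} + M"
      by (subst proots_mult) (use add.IH in \<open>auto simp del: mult_pCons_left\<close>)
    then show ?case
      by (simp del: mult_pCons_left)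
  qed auto
  finally have "size (proots P) = Polynomial.degree P"
    using M(1) by simp
  then show ?thesis
    using assms by (simp add: size_multiset_overloaded_eq)
qed

lemma card_preimage_poly:
  fixes P :: "'a::{alg_closed_field,field_char_0} poly"
  assumes "Polynomial.degree P > 0" "finite B"
  shows "finite (poly P -` B)"
    and "card B * Polynomial.degree P < card (poly P -` B) + Polynomial.degree P"
proof -
  let ?d = "Polynomial.degree P"
  define F where "F b = {a. poly (P - [:b:]) a = 0}" for b
  have nz: "P - [:b:] \<noteq> 0" for b
    using assms(1) by auto
  have deg: "Polynomial.degree (P - [:b:]) = ?d" for b
    using assms(1) by (metis degree_add_eq_left degree_minus degree_pCons_0 diff_conv_add_uminus)
  have finF: "finite (F b)" for b
    unfolding F_def by (rule poly_roots_finite[OF nz])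
  have A: "poly P -` B = (\<Union>b\<in>B. F b)"
    by (auto simp: F_def)
  show fin: "finite (poly P -` B)"
    unfolding A using assms(2) finF by blast
  have dP: "pderiv P \<noteq> 0"
    using assms(1) by (simp add: pderiv_eq_0_iff)
  have "(\<Sum>a\<in>F b. Suc (order a (pderiv P))) = ?d" for b
  proof -
    have "(\<Sum>a\<in>F b. Suc (order a (pderiv P))) = (\<Sum>a\<in>F b. order a (P - [:b:]))"
      using order_pderiv[OF nz[of b]] by (intro sum.cong) (auto simp: F_def pderiv_diff pderiv_pCons)
    then show ?thesis
      using sum_order_fibre[OF nz[of b]] deg[of b] by (simp add: F_def)
  qed
  then have "(\<Sum>b\<in>B. \<Sum>a\<in>F b. Suc (order a (pderiv P))) = card B * ?d"
    by simp
  moreover have "(\<Sum>b\<in>B. \<Sum>a\<in>F b. Suc (order a (pderiv P))) = (\<Sum>a\<in>poly P -` B. Suc (order a (pderiv P)))"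
    unfolding A by (rule sum.UNION_disjoint[symmetric]) (use assms(2) finF in \<open>auto simp: F_def\<close>)
  moreover have "(\<Sum>a\<in>poly P -` B. order a (pderiv P)) \<le> Polynomial.degree (pderiv P)"
  proof -
    have "(\<Sum>a\<in>poly P -` B. order a (pderiv P))
        = (\<Sum>a\<in>poly P -` B \<inter> {a. poly (pderiv P) a = 0}. order a (pderiv P))"
      by (rule sum.mono_neutral_right) (use fin dP in \<open>auto simp: order_root\<close>)
    also have "\<dots> \<le> (\<Sum>a | poly (pderiv P) a = 0. order a (pderiv P))"
      by (rule sum_mono2) (use poly_roots_finite[OF dP] in auto)
    finally show ?thesis
      using sum_order_fibre[OF dP] by simp
  qed
  ultimately show "card B * ?d < card (poly P -` B) + ?d"
    using assms(1) by (simp add: sum.distrib sum_Suc degree_pderiv)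
qed

lemma poly_equiv_iff_linear:
  fixes A B :: "'a::{alg_closed_field,field_char_0} set"
  assumes "A \<in> nsets n" "n \<ge> 2"
  shows "B \<equiv>\<^sub>p A \<longleftrightarrow> (\<exists>c c'. c \<noteq> 0 \<and> B = (\<lambda>x. c * x + c') ` A)"
proof
  assume "\<exists>c c'. c \<noteq> 0 \<and> B = (\<lambda>x. c * x + c') ` A"
  then obtain c c' where c: "c \<noteq> 0" and B: "B = (\<lambda>x. c * x + c') ` A"
    by blast
  have "A = poly [:c', c:] -` B"
    using c by (auto simp: B algebra_simps)
  moreover have "B = poly [:- c' / c, 1 / c:] -` A"
  proof (intro equalityI subsetI)
    fix y assume "y \<in> poly [:- c' / c, 1 / c:] -` A"
    then have "(y - c') / c \<in> A"
      by (simp add: diff_divide_distrib)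
    moreover have "y = c * ((y - c') / c) + c'"
      using c by simp
    ultimately show "y \<in> B"
      unfolding B by blast
  qed (use c in \<open>auto simp: B field_simps\<close>)
  ultimately show "B \<equiv>\<^sub>p A"
    unfolding poly_equiv_def poly_le_def by blast
next
  assume "B \<equiv>\<^sub>p A"
  then obtain P Q where P: "B = poly P -` A" and Q: "A = poly Q -` B"
    by (auto simp: poly_equiv_def poly_le_def)
  have A: "finite A" "card A = n" "A \<noteq> {}" "A \<noteq> UNIV"
    using assms infinite_UNIV_char_0 by (auto simp: nsets_def)
  have dQ: "Polynomial.degree Q > 0"
  proof (rule ccontr)
    assume "\<not> ?thesis"
    then obtain q where "Q = [:q:]"
      using degree_eq_zeroE by blast
    with Q A(3,4) show False
      by (cases "q \<in> B") auto
  qed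
  have dP: "Polynomial.degree P > 0"
  proof (rule ccontr)
    assume "\<not> ?thesis"
    then obtain q where "P = [:q:]"
      using degree_eq_zeroE by blast
    with P have "B = {} \<or> B = UNIV"
      by (cases "q \<in> A") auto
    with Q A(3,4) show False
      by auto
  qed
  have finB: "finite B" and 1: "n * Polynomial.degree P < card B + Polynomial.degree P"
    using card_preimage_poly[OF dP A(1)] A(2) by (simp_all add: P)
  have 2: "card B * Polynomial.degree Q < n + Polynomial.degree Q"
    using card_preimage_poly(2)[OF dQ finB] A(2) by (simp flip: Q)
  obtain m where m: "n = Suc m" "m \<ge> 1"
    using assms(2) by (cases n) auto
  have "m * 1 \<le> m * Polynomial.degree P"
    using dP by (intro mult_le_mono2) simp
  moreover have "m * Polynomial.degree P < card B"
    using 1 m by simp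
  ultimately have "Suc m \<le> card B"
    by linarith
  then have "Suc m * Polynomial.degree Q \<le> card B * Polynomial.degree Q"
    by (rule mult_le_mono1)
  then have "m * Polynomial.degree Q < Suc m"
    using 2 m(1) by simp
  also have "Suc m \<le> m * 2"
    using m(2) by simp
  finally have "m * Polynomial.degree Q < m * 2" .
  then have "Polynomial.degree Q < 2"
    by simp
  with dQ have "Polynomial.degree Q = 1"
    by simp
  then obtain c c' where Qc: "Q = [:c', c:]" "c \<noteq> 0"
    by (rule degree1_coeffs)
  have "B = (\<lambda>x. c * x + c') ` A"
  proof (intro equalityI subsetI)
    fix y assume "y \<in> B"
    have y: "y = c * ((y - c') / c) + c'"
      using Qc(2) by simp
    then have "(y - c') / c \<in> A"
      using Q Qc \<open>y \<in> B\<close> by (simp add: add.commute)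
    with y show "y \<in> (\<lambda>x. c * x + c') ` A"
      by blast
  qed (use Q Qc in \<open>auto simp: add.commute mult.commute\<close>)
  with Qc(2) show "\<exists>c c'. c \<noteq> 0 \<and> B = (\<lambda>x. c * x + c') ` A"
    by blast
qed

lemma poly_class_eq_iff:
  fixes A B :: "'a::{alg_closed_field,field_char_0} set"
  assumes "A \<in> nsets n" "n \<ge> 2"
  shows "poly_class A = poly_class B \<longleftrightarrow> (\<exists>c c'. c \<noteq> 0 \<and> B = (\<lambda>x. c * x + c') ` A)"
  using assms by (simp add: poly_class_eq_iff_equiv poly_equiv_iff_linear)

end

theory Submission
  imports Defs "HOL-Combinatorics.Cycles"
begin

text \<open>
  Both varieties are quotients of the space of \<open>n\<close>-tuples with distinct coordinates, and both have
  the same shape: every tuple \<open>x\<close> is moved to a representative \<open>N x\<close> in a slice, and two points of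
  the slice have the same projection iff some map \<open>x \<mapsto> N (x \<circ> \<sigma>)\<close>, with \<open>\<sigma>\<close> one of the finitely
  many permutations, takes one to the other. For the variety of sets, \<open>N\<close> is the identity. For
  the variety of classes, \<open>N\<close> is the unique affine substitution with \<open>x\<^sub>1 \<mapsto> 0\<close> and
  \<open>x\<^sub>2 \<mapsto> 1\<close>, so that the slice has
  the \<open>n - 2\<close> remaining coordinates as parameters. The locale \<open>slice_quotient\<close> treats both at once.

  Upper bounds come from transcendence degree, in elementary form. Along a strict chain
  \<open>Z\<^sub>0 \<subset> \<dots> \<subset> Z\<^sub>d\<close> of irreducible closed sets choose regular functions \<open>g\<^sub>i\<close> vanishing on
  \<open>Z\<^sub>i\<^sub>-\<^sub>1\<close> but not on \<open>Z\<^sub>i\<close>. They are algebraically independent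
  (\<open>chain_functions_independent\<close>). If the space is parametrized by \<open>m\<close> variables, then the
  \<open>g\<^sub>i\<close> are rational functions of \<open>m\<close> variables, and counting monomials makes more than \<open>m\<close> of
  these dependent (\<open>rational_functions_dependent\<close>); hence \<open>d \<le> m\<close>. The functions \<open>g\<^sub>i\<close> exist
  because invariant regular functions separate points from closed sets
  (\<open>regular_functions_separate\<close>). A polynomial class has the two parameters \<open>c\<close>, \<open>c'\<close> of
  \<open>cX + c'\<close>.

  Lower bounds come from chains of linear subspaces inside the slice. These are irreducible because
  a polynomial that does not vanish identically on a line has only finitely many zeros there. Their images in the quotient are
  closed, since only finitely many permutations are involved, and they remain strictly increasing:
  otherwise some \<open>x \<mapsto> N (x \<circ> \<sigma>)\<close> would map an irreducible set into a proper subset of itself,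
  which a map of finite order cannot do (\<open>q_image_subset_imp_subset\<close>).
\<close>

section \<open>Rings of functions\<close>

text \<open>
  Regular functions, polynomial functions in several variables, and one-variable polynomials all form
  such rings; evaluating a polynomial at members of the ring stays inside it.
\<close>

definition function_ring :: "('p \<Rightarrow> 'a::comm_ring_1) set \<Rightarrow> bool"
  where "function_ring R \<longleftrightarrow> (\<forall>c. (\<lambda>_. c) \<in> R) \<and>
    (\<forall>u\<in>R. \<forall>v\<in>R. (\<lambda>x. u x + v x) \<in> R \<and> (\<lambda>x. u x * v x) \<in> R)"

context
  fixes R :: "('p \<Rightarrow> 'a::comm_ring_1) set"
  assumes R: "function_ring R"
begin

lemma function_ring_const: "(\<lambda>_. c) \<in> R"
  using R by (auto simp: function_ring_def)

lemma function_ring_add: "u \<in> R \<Longrightarrow> v \<in> R \<Longrightarrow> (\<lambda>x. u x + v x) \<in> R"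
  using R by (auto simp: function_ring_def)

lemma function_ring_mult: "u \<in> R \<Longrightarrow> v \<in> R \<Longrightarrow> (\<lambda>x. u x * v x) \<in> R"
  using R by (auto simp: function_ring_def)

lemma function_ring_diff:
  assumes "u \<in> R" "v \<in> R"
  shows "(\<lambda>x. u x - v x) \<in> R"
  using function_ring_add[OF assms(1) function_ring_mult[OF function_ring_const[of "-1"] assms(2)]]
  by simp

lemma function_ring_power: "u \<in> R \<Longrightarrow> (\<lambda>x. u x ^ k) \<in> R"
  by (induction k) (auto intro: function_ring_const function_ring_mult)

lemma function_ring_sum: "(\<And>i. i \<in> I \<Longrightarrow> u i \<in> R) \<Longrightarrow> (\<lambda>x. \<Sum>i\<in>I. u i x) \<in> R"
  by (induction I rule: infinite_finite_induct) (auto intro: function_ring_const function_ring_add)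

lemma function_ring_prod: "(\<And>i. i \<in> I \<Longrightarrow> u i \<in> R) \<Longrightarrow> (\<lambda>x. \<Prod>i\<in>I. u i x) \<in> R"
  by (induction I rule: infinite_finite_induct) (auto intro: function_ring_const function_ring_mult)

lemma function_ring_meval:
  assumes "p \<in> mpolys n" and u: "\<And>i. i \<in> {1..n} \<Longrightarrow> u i \<in> R"
  shows "(\<lambda>x. meval p (\<lambda>i. u i x)) \<in> R"
  unfolding meval_def meval_monom_def
  by (intro function_ring_sum function_ring_mult function_ring_const function_ring_prod
      function_ring_power u) (use assms(1) in \<open>auto simp: mpolys_def subset_iff\<close>)

end

lemma mpolys_add: "p \<in> mpolys n \<Longrightarrow> q \<in> mpolys n \<Longrightarrow> p + q \<in> mpolys n"
  using Poly_Mapping.keys_add[of p q] by (auto simp: mpolys_def)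

lemma mpolys_const: "Poly_Mapping.single 0 c \<in> mpolys n"
  by (simp add: mpolys_def)

lemma meval_const [simp]: "meval (Poly_Mapping.single 0 c) x = c"
  by (simp add: meval_single meval_monom_def)

lemma mpolys_mvar: "i \<in> {1..n} \<Longrightarrow> mvar i \<in> mpolys n"
  by (simp add: mpolys_def mvar_def)

lemma mpolys_diff: "p \<in> mpolys n \<Longrightarrow> q \<in> mpolys n \<Longrightarrow> p - q \<in> mpolys n"
  using keys_diff[of p q] by (auto simp: mpolys_def)

lemma mpolys_power: "p \<in> mpolys n \<Longrightarrow> p ^ k \<in> mpolys n"
  by (induction k) (auto simp: mpolys_one mpolys_mult)

lemma mpolys_prod: "(\<And>i. i \<in> I \<Longrightarrow> p i \<in> mpolys n) \<Longrightarrow> (\<Prod>i\<in>I. p i) \<in> mpolys n"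
  by (induction I rule: infinite_finite_induct) (auto simp: mpolys_one mpolys_mult)

lemma meval_power: "meval (p ^ k) x = meval p x ^ k"
  by (induction k) (auto simp: meval_mult)

definition poly_funs :: "nat \<Rightarrow> ((nat \<Rightarrow> 'a) \<Rightarrow> 'a::comm_ring_1) set"
  where "poly_funs m = meval ` mpolys m"

lemma function_ring_poly_funs: "function_ring (poly_funs m)"
  unfolding function_ring_def poly_funs_def
proof (intro conjI allI ballI)
  fix c :: 'a
  have "(\<lambda>_. c) = meval (Poly_Mapping.single 0 c)" by (rule ext) simp
  then show "(\<lambda>_. c) \<in> meval ` mpolys m" using mpolys_const by blast
next
  fix u v :: "(nat \<Rightarrow> 'a) \<Rightarrow> 'a" assume "u \<in> meval ` mpolys m" "v \<in> meval ` mpolys m"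
  then obtain p q where pq: "p \<in> mpolys m" "q \<in> mpolys m" "u = meval p" "v = meval q" by blast
  have "(\<lambda>x. u x + v x) = meval (p + q)" "(\<lambda>x. u x * v x) = meval (p * q)"
    by (auto simp: pq meval_add meval_mult)
  then show "(\<lambda>x. u x + v x) \<in> meval ` mpolys m" "(\<lambda>x. u x * v x) \<in> meval ` mpolys m"
    using pq mpolys_add mpolys_mult by blast+
qed

lemma poly_funs_coordinate: "i \<in> {1..m} \<Longrightarrow> (\<lambda>t. t i) \<in> poly_funs m"
  unfolding poly_funs_def
  by (rule image_eqI[OF _ mpolys_mvar]) auto

section \<open>Algebraic dependence by counting monomials\<close>

text \<open>Gaussian elimination: one unknown is used to eliminate one equation.\<close>

lemma linear_dependency:
  fixes a :: "'j \<Rightarrow> 'k \<Rightarrow> 'a::field"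
  assumes "finite K" "finite J" "card K < card J"
  shows "\<exists>c. (\<exists>j\<in>J. c j \<noteq> 0) \<and> (\<forall>k\<in>K. (\<Sum>j\<in>J. c j * a j k) = 0)"
  using assms
proof (induction K arbitrary: J a rule: finite_induct)
  case empty
  then have "J \<noteq> {}" by auto
  then show ?case by (intro exI[of _ "\<lambda>_. 1"]) auto
next
  case (insert k0 K)
  show ?case
  proof (cases "\<forall>j\<in>J. a j k0 = 0")
    case True
    obtain c where "\<exists>j\<in>J. c j \<noteq> 0" "\<forall>k\<in>K. (\<Sum>j\<in>J. c j * a j k) = 0"
      using insert.IH[of J a] insert.prems insert.hyps by auto
    with True show ?thesis by auto
  next
    case False
    then obtain j0 where j0: "j0 \<in> J" "a j0 k0 \<noteq> 0" by blast
    define r where "r j = a j k0 / a j0 k0" for j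
    define J' where "J' = J - {j0}"
    have J: "J = insert j0 J'" "j0 \<notin> J'" "finite J'"
      using j0 insert.prems by (auto simp: J'_def)
    have "card K < card J'" using insert J by simp
    then obtain c where c: "\<exists>j\<in>J'. c j \<noteq> 0"
        "\<And>k. k \<in> K \<Longrightarrow> (\<Sum>j\<in>J'. c j * (a j k - r j * a j0 k)) = 0"
      using insert.IH[of J' "\<lambda>j k. a j k - r j * a j0 k"] J(3) by blast
    \<comment> \<open>the value at \<open>j0\<close> is forced by the equation \<open>k0\<close>\<close>
    define c' where "c' = c(j0 := - (\<Sum>j\<in>J'. c j * r j))"
    have c'J: "(\<Sum>j\<in>J. c' j * a j k) = (\<Sum>j\<in>J'. c j * (a j k - r j * a j0 k))" for k
    proof -
      have "(\<Sum>j\<in>J'. c' j * a j k) = (\<Sum>j\<in>J'. c j * a j k)"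
        using J(2) by (intro sum.cong) (auto simp: c'_def)
      then show ?thesis
        using J by (simp add: c'_def sum_subtractf algebra_simps sum_distrib_left sum_distrib_right)
    qed
    have "(\<Sum>j\<in>J. c' j * a j k) = 0" if "k \<in> insert k0 K" for k
      using that c(2) j0(2) by (auto simp: c'J r_def)
    moreover have "\<exists>j\<in>J. c' j \<noteq> 0"
      using c(1) J by (auto simp: c'_def)
    ultimately show ?thesis by blast
  qed
qed

text \<open>
  Bounding each exponent separately, rather than the total degree, makes the number of monomials a
  plain power \<open>(e + 1) ^ m\<close>.
\<close>

definition bounded_exponents :: "nat \<Rightarrow> nat \<Rightarrow> (nat \<Rightarrow>\<^sub>0 nat) set"
  where "bounded_exponents m e =
    {k. Poly_Mapping.keys k \<subseteq> {1..m} \<and> (\<forall>i. Poly_Mapping.lookup k i \<le> e)}"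

definition bounded_mpolys :: "nat \<Rightarrow> nat \<Rightarrow> 'a::comm_ring_1 mpoly set"
  where "bounded_mpolys m e = {p. Poly_Mapping.keys p \<subseteq> bounded_exponents m e}"

lemma card_bounded_exponents:
  "finite (bounded_exponents m e) \<and> card (bounded_exponents m e) \<le> (e + 1) ^ m"
proof -
  let ?r = "\<lambda>k. restrict (Poly_Mapping.lookup k) {1..m}"
  let ?T = "PiE {1..m} (\<lambda>_. {..e})"
  have inj: "inj_on ?r (bounded_exponents m e)"
  proof (rule inj_onI)
    fix k l assume k: "k \<in> bounded_exponents m e" and l: "l \<in> bounded_exponents m e" and eq: "?r k = ?r l"
    show "k = l"
    proof (rule poly_mapping_eqI)
      fix i
      show "Poly_Mapping.lookup k i = Poly_Mapping.lookup l i"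
      proof (cases "i \<in> {1..m}")
        case True
        then show ?thesis using fun_cong[OF eq, of i] by simp
      next
        case False
        then have "i \<notin> Poly_Mapping.keys k" "i \<notin> Poly_Mapping.keys l"
          using k l by (auto simp: bounded_exponents_def)
        then show ?thesis by (simp add: in_keys_iff)
      qed
    qed
  qed
  have sub: "?r ` bounded_exponents m e \<subseteq> ?T"
    by (auto simp: bounded_exponents_def)
  have fin: "finite ?T" by (simp add: finite_PiE)
  have card: "card ?T = (e + 1) ^ m" by (simp add: card_PiE)
  show ?thesis
    using inj_on_finite[OF inj sub fin] card_inj_on_le[OF inj sub fin] card by simp
qed

lemma bounded_mpolys_mono:
  assumes "e \<le> e'"
  shows "bounded_mpolys m e \<subseteq> bounded_mpolys m e'"
proof -
  have "bounded_exponents m e \<subseteq> bounded_exponents m e'"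
    unfolding bounded_exponents_def using le_trans[OF _ assms] by blast
  then show ?thesis
    unfolding bounded_mpolys_def by blast
qed

lemma bounded_mpolys_one: "1 \<in> bounded_mpolys m 0"
  by (simp add: bounded_mpolys_def bounded_exponents_def)

lemma bounded_mpolys_mult:
  assumes "p \<in> bounded_mpolys m e" "q \<in> bounded_mpolys m e'"
  shows "p * q \<in> bounded_mpolys m (e + e')"
proof -
  have "k \<in> bounded_exponents m (e + e')" if "k \<in> Poly_Mapping.keys (p * q)" for k
  proof -
    from that keys_mult[of p q] obtain a b
      where ab: "k = a + b" "a \<in> Poly_Mapping.keys p" "b \<in> Poly_Mapping.keys q"
      by blast
    then have "a \<in> bounded_exponents m e" "b \<in> bounded_exponents m e'"
      using assms by (auto simp: bounded_mpolys_def)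
    with ab(1) Poly_Mapping.keys_add[of a b] show ?thesis
      by (auto simp: bounded_exponents_def lookup_add intro: add_mono)
  qed
  then show ?thesis by (auto simp: bounded_mpolys_def)
qed

lemma bounded_mpolys_power: "p \<in> bounded_mpolys m e \<Longrightarrow> p ^ k \<in> bounded_mpolys m (k * e)"
  by (induction k) (auto simp: bounded_mpolys_one intro: bounded_mpolys_mult)

lemma bounded_mpolys_prod:
  "finite I \<Longrightarrow> (\<And>i. i \<in> I \<Longrightarrow> p i \<in> bounded_mpolys m e) \<Longrightarrow>
    (\<Prod>i\<in>I. p i) \<in> bounded_mpolys m (card I * e)"
  by (induction I rule: finite_induct) (auto simp: bounded_mpolys_one intro: bounded_mpolys_mult)

lemma mpolys_bounded:
  assumes "p \<in> mpolys m"
  shows "\<exists>e. p \<in> bounded_mpolys m e"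
proof -
  define e where "e = (\<Sum>k\<in>Poly_Mapping.keys p. \<Sum>i\<in>Poly_Mapping.keys k. Poly_Mapping.lookup k i)"
  have "Poly_Mapping.lookup k i \<le> e" if k: "k \<in> Poly_Mapping.keys p" for k i
  proof (cases "i \<in> Poly_Mapping.keys k")
    case True
    then have "Poly_Mapping.lookup k i \<le> (\<Sum>i\<in>Poly_Mapping.keys k. Poly_Mapping.lookup k i)"
      by (intro member_le_sum) auto
    also have "\<dots> \<le> e"
      unfolding e_def
      by (rule member_le_sum[OF k, of "\<lambda>k. \<Sum>i\<in>Poly_Mapping.keys k. Poly_Mapping.lookup k i"]) auto
    finally show ?thesis .
  qed (simp add: in_keys_iff)
  with assms show ?thesis
    by (auto simp: bounded_mpolys_def bounded_exponents_def mpolys_def intro!: exI[of _ e])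
qed

text \<open>
  The coefficients of a relation solve a linear system with one equation per monomial.
\<close>

lemma bounded_mpolys_dependent:
  fixes p :: "'j \<Rightarrow> 'a::field mpoly"
  assumes "finite J" "(e + 1) ^ m < card J" "\<And>j. j \<in> J \<Longrightarrow> p j \<in> bounded_mpolys m e"
  shows "\<exists>c. (\<exists>j\<in>J. c j \<noteq> 0) \<and> (\<forall>t. (\<Sum>j\<in>J. c j * meval (p j) t) = 0)"
proof -
  let ?K = "bounded_exponents m e"
  have K: "finite ?K" "card ?K < card J"
    using card_bounded_exponents[of m e] assms(2) by auto
  obtain c where c: "\<exists>j\<in>J. c j \<noteq> 0"
      "\<And>k. k \<in> ?K \<Longrightarrow> (\<Sum>j\<in>J. c j * Poly_Mapping.lookup (p j) k) = 0"
    using linear_dependency[OF K(1) assms(1) K(2), of "\<lambda>j k. Poly_Mapping.lookup (p j) k"] by blast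
  have "(\<Sum>j\<in>J. c j * meval (p j) t) = 0" for t
  proof -
    have "(\<Sum>j\<in>J. c j * meval (p j) t) =
        (\<Sum>j\<in>J. \<Sum>k\<in>?K. (c j * Poly_Mapping.lookup (p j) k) * meval_monom t k)"
      using assms(3)
      by (intro sum.cong) (auto simp: meval_superset[OF K(1)] bounded_mpolys_def sum_distrib_left mult.assoc)
    also have "\<dots> = (\<Sum>k\<in>?K. (\<Sum>j\<in>J. c j * Poly_Mapping.lookup (p j) k) * meval_monom t k)"
      by (subst sum.swap) (simp add: sum_distrib_right)
    also have "\<dots> = 0" using c(2) by simp
    finally show ?thesis .
  qed
  with c(1) show ?thesis by blast
qed

text \<open>
  There are \<open>N ^ d\<close> monomials in the \<open>d\<close> given fractions with all exponents below \<open>N\<close>. Over the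
  common denominator \<open>\<Prod>i. h i ^ N\<close> their numerators have exponents at most \<open>d * N * E\<close> in each
  of the \<open>m\<close> variables, so they live in a space whose dimension grows like \<open>N ^ m\<close>. As \<open>m < d\<close>,
  a large \<open>N\<close> forces a linear relation. The finite set \<open>M\<close> of exponent vectors and the
  coefficients \<open>c\<close> describe the relating polynomial.
\<close>

lemma rational_functions_dependent:
  fixes p h :: "nat \<Rightarrow> 'a::field mpoly"
  assumes "m < d" and p: "\<And>i. i \<in> {1..d} \<Longrightarrow> p i \<in> mpolys m"
    and h: "\<And>i. i \<in> {1..d} \<Longrightarrow> h i \<in> mpolys m"
  shows "\<exists>M c. finite M \<and> M \<subseteq> {1..d} \<rightarrow>\<^sub>E UNIV \<and> (\<exists>\<beta>\<in>M. c \<beta> \<noteq> 0) \<and>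
    (\<forall>t. (\<forall>i\<in>{1..d}. meval (h i) t \<noteq> 0) \<longrightarrow>
      (\<Sum>\<beta>\<in>M. c \<beta> * (\<Prod>i\<in>{1..d}. (meval (p i) t / meval (h i) t) ^ \<beta> i)) = 0)"
proof -
  have "\<forall>i\<in>{1..d}. \<exists>e. p i \<in> bounded_mpolys m e \<and> h i \<in> bounded_mpolys m e"
  proof
    fix i assume i: "i \<in> {1..d}"
    obtain a b where "p i \<in> bounded_mpolys m a" "h i \<in> bounded_mpolys m b"
      using mpolys_bounded p[OF i] h[OF i] by metis
    then have "p i \<in> bounded_mpolys m (a + b)" "h i \<in> bounded_mpolys m (a + b)"
      using bounded_mpolys_mono[of a "a + b" m] bounded_mpolys_mono[of b "a + b" m] by auto
    then show "\<exists>e. p i \<in> bounded_mpolys m e \<and> h i \<in> bounded_mpolys m e" by blast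
  qed
  then obtain e where e: "\<And>i. i \<in> {1..d} \<Longrightarrow> p i \<in> bounded_mpolys m (e i) \<and> h i \<in> bounded_mpolys m (e i)"
    by metis
  define E where "E = sum e {1..d}"
  have E: "p i \<in> bounded_mpolys m E \<and> h i \<in> bounded_mpolys m E" if "i \<in> {1..d}" for i
  proof -
    have "e i \<le> E" unfolding E_def using that by (intro member_le_sum) auto
    then show ?thesis using e[OF that] bounded_mpolys_mono by blast
  qed
  \<comment> \<open>chosen so that \<open>(N * (d * E + 1)) ^ m < N ^ Suc m\<close>\<close>
  define N where "N = (d * E + 1) ^ m + 1"
  define M where "M = ({1..d} \<rightarrow>\<^sub>E {..<N})"
  have M: "finite M" "card M = N ^ d"
    by (auto simp: M_def finite_PiE card_PiE)
  have "(d * (N * E) + 1) ^ m \<le> (N * (d * E + 1)) ^ m"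
    by (rule power_mono) (auto simp: N_def algebra_simps)
  also have "\<dots> < N ^ m * N"
    unfolding power_mult_distrib by (rule mult_strict_left_mono) (simp_all add: N_def)
  also have "\<dots> = N ^ Suc m" by simp
  also have "\<dots> \<le> N ^ d"
    using assms(1) by (intro power_increasing) (auto simp: N_def)
  finally have cardlt: "(d * (N * E) + 1) ^ m < card M" by (simp add: M)
  define P where "P \<beta> = (\<Prod>i\<in>{1..d}. p i ^ \<beta> i * h i ^ (N - \<beta> i))" for \<beta> :: "nat \<Rightarrow> nat"
  have P: "P \<beta> \<in> bounded_mpolys m (d * (N * E))" if "\<beta> \<in> M" for \<beta>
  proof -
    have *: "p i ^ \<beta> i * h i ^ (N - \<beta> i) \<in> bounded_mpolys m (N * E)" if i: "i \<in> {1..d}" for i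
    proof -
      have "\<beta> i < N" using \<open>\<beta> \<in> M\<close> i by (auto simp: M_def PiE_def Pi_def)
      then have "\<beta> i * E + (N - \<beta> i) * E = N * E" by (simp flip: add_mult_distrib)
      moreover have "p i ^ \<beta> i * h i ^ (N - \<beta> i) \<in> bounded_mpolys m (\<beta> i * E + (N - \<beta> i) * E)"
        using E[OF i] by (intro bounded_mpolys_mult bounded_mpolys_power) simp_all
      ultimately show ?thesis by simp
    qed
    have "P \<beta> \<in> bounded_mpolys m (card {1..d} * (N * E))"
      unfolding P_def
    proof (rule bounded_mpolys_prod[OF finite_atLeastAtMost])
      show "p i ^ \<beta> i * h i ^ (N - \<beta> i) \<in> bounded_mpolys m (N * E)" if "i \<in> {1..d}" for i
        by (rule *[OF that])
    qed
    then show ?thesis by simp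
  qed
  have "\<exists>c. (\<exists>\<beta>\<in>M. c \<beta> \<noteq> 0) \<and> (\<forall>t. (\<Sum>\<beta>\<in>M. c \<beta> * meval (P \<beta>) t) = 0)"
    by (rule bounded_mpolys_dependent[OF M(1) cardlt P])
  then obtain c where c: "\<exists>\<beta>\<in>M. c \<beta> \<noteq> 0" "\<And>t. (\<Sum>\<beta>\<in>M. c \<beta> * meval (P \<beta>) t) = 0"
    by blast
  have "(\<Sum>\<beta>\<in>M. c \<beta> * (\<Prod>i\<in>{1..d}. (meval (p i) t / meval (h i) t) ^ \<beta> i)) = 0"
    if t: "\<forall>i\<in>{1..d}. meval (h i) t \<noteq> 0" for t
  proof -
    let ?H = "\<Prod>i\<in>{1..d}. meval (h i) t ^ N"
    have H: "?H \<noteq> 0" using t by simp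
    have "meval (P \<beta>) t = ?H * (\<Prod>i\<in>{1..d}. (meval (p i) t / meval (h i) t) ^ \<beta> i)" if \<beta>: "\<beta> \<in> M" for \<beta>
      unfolding P_def meval_prod prod.distrib[symmetric]
    proof (rule prod.cong[OF refl])
      fix i assume i: "i \<in> {1..d}"
      have "\<beta> i < N" using \<beta> i by (auto simp: M_def PiE_def Pi_def)
      then have "meval (h i) t ^ N = meval (h i) t ^ \<beta> i * meval (h i) t ^ (N - \<beta> i)"
        by (simp flip: power_add)
      then show "meval (p i ^ \<beta> i * h i ^ (N - \<beta> i)) t =
          meval (h i) t ^ N * (meval (p i) t / meval (h i) t) ^ \<beta> i"
        using t i by (simp add: meval_mult meval_power power_divide)
    qed
    then have "?H * (\<Sum>\<beta>\<in>M. c \<beta> * (\<Prod>i\<in>{1..d}. (meval (p i) t / meval (h i) t) ^ \<beta> i)) =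
        (\<Sum>\<beta>\<in>M. c \<beta> * meval (P \<beta>) t)"
      by (simp add: sum_distrib_left mult_ac)
    then show ?thesis using H unfolding c(2) mult_eq_0_iff by blast
  qed
  moreover have "M \<subseteq> {1..d} \<rightarrow>\<^sub>E UNIV" by (auto simp: M_def)
  ultimately show ?thesis using M(1) c(1) by blast
qed

section \<open>Krull dimension\<close>

lemma irreducible_space_subset_cases:
  assumes "irreducible_space (subtopology X Z)" "Z \<subseteq> topspace X"
    and "closedin X C" "closedin X C'" "Z \<subseteq> C \<union> C'"
  shows "Z \<subseteq> C \<or> Z \<subseteq> C'"
proof -
  have "closedin (subtopology X Z) (Z \<inter> C)" "closedin (subtopology X Z) (Z \<inter> C')"
    using assms(3,4) by (auto simp: closedin_subtopology)
  moreover have "topspace (subtopology X Z) = Z" using assms(2) by auto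
  moreover have "Z \<inter> C \<union> Z \<inter> C' = Z" using assms(5) by auto
  ultimately have "Z \<inter> C = Z \<or> Z \<inter> C' = Z"
    using assms(1) unfolding irreducible_space_def by metis
  then show ?thesis by blast
qed

text \<open>An empty cover is excluded because irreducible spaces are nonempty.\<close>

lemma irreducible_space_finite_cover:
  assumes "irreducible_space (subtopology X Z)" "Z \<subseteq> topspace X" "finite I"
    and "\<And>i. i \<in> I \<Longrightarrow> closedin X (C i)" "Z \<subseteq> (\<Union>i\<in>I. C i)"
  shows "\<exists>i\<in>I. Z \<subseteq> C i"
  using assms(3-5)
proof (induction I rule: finite_induct)
  case empty
  then have "topspace (subtopology X Z) = {}" by auto
  then show ?case using assms(1) by (simp add: irreducible_space_def)
next
  case (insert i I)
  have "Z \<subseteq> C i \<or> Z \<subseteq> (\<Union>i\<in>I. C i)"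
    by (rule irreducible_space_subset_cases[OF assms(1,2)])
       (use insert in \<open>auto intro!: closedin_Union\<close>)
  with insert show ?case by auto
qed

lemma irreducible_space_image:
  assumes "irreducible_space X" "continuous_map X Y f" "f ` topspace X = topspace Y"
  shows "irreducible_space Y"
  unfolding irreducible_space_def
proof (intro conjI allI impI)
  show "topspace Y \<noteq> {}"
    using assms(1,3) by (auto simp: irreducible_space_def)
  fix C D assume CD: "closedin Y C \<and> closedin Y D \<and> C \<union> D = topspace Y"
  let ?C = "{x\<in>topspace X. f x \<in> C}" and ?D = "{x\<in>topspace X. f x \<in> D}"
  have "closedin X ?C" "closedin X ?D"
    using CD assms(2) by (auto intro: closedin_continuous_map_preimage)
  moreover have "?C \<union> ?D = topspace X" using CD assms(3) by auto
  ultimately have "?C = topspace X \<or> ?D = topspace X"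
    using assms(1) unfolding irreducible_space_def by metis
  then have "topspace Y \<subseteq> C \<or> topspace Y \<subseteq> D" unfolding assms(3)[symmetric] by blast
  then show "C = topspace Y \<or> D = topspace Y"
    using CD closedin_subset by blast
qed

lemma irreducible_closedin_subtopology:
  assumes "irreducible_closedin X Z" "Z \<subseteq> S"
  shows "irreducible_closedin (subtopology X S) Z"
  using assms
  by (auto simp: irreducible_closedin_def closedin_subset_topspace subtopology_subtopology Int_absorb1)

lemma krull_dim_geI:
  assumes "\<And>i. i \<le> d \<Longrightarrow> irreducible_closedin X (Z i)" "\<And>i. i < d \<Longrightarrow> Z i \<subset> Z (Suc i)"
  shows "ereal (real d) \<le> krull_dim X"
  unfolding krull_dim_def using assms by (intro Sup_upper) blast

text \<open>
  Algebraic independence along a chain, by induction on its length. In a relation on \<open>Z (Suc d)\<close>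
  divide by the largest power of the last function \<open>g (Suc d)\<close> common to all terms; this is allowed
  since \<open>Z (Suc d)\<close> is irreducible and \<open>g (Suc d)\<close> is not identically zero there. On \<open>Z d\<close> the
  last function vanishes, so only the terms without a remaining factor \<open>g (Suc d)\<close> survive, and
  they form a nontrivial relation between the earlier functions.
\<close>

lemma chain_functions_independent:
  fixes R :: "('p \<Rightarrow> 'a::idom) set"
  assumes ring: "function_ring R"
    and closed: "\<And>u. u \<in> R \<Longrightarrow> closedin X {x\<in>topspace X. u x = 0}"
    and irr: "\<And>i. i \<le> d \<Longrightarrow> irreducible_closedin X (Z i)"
    and chain: "\<And>i. i < d \<Longrightarrow> Z i \<subseteq> Z (Suc i)"
    and g: "\<And>i. i \<in> {1..d} \<Longrightarrow> g i \<in> R"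
    and g0: "\<And>i x. i < d \<Longrightarrow> x \<in> Z i \<Longrightarrow> g (Suc i) x = 0"
    and g1: "\<And>i. i \<in> {1..d} \<Longrightarrow> \<exists>x\<in>Z i. g i x \<noteq> 0"
    and M: "finite M" "M \<subseteq> {1..d} \<rightarrow>\<^sub>E UNIV"
    and rel: "\<And>x. x \<in> Z d \<Longrightarrow> (\<Sum>\<beta>\<in>M. c \<beta> * (\<Prod>i\<in>{1..d}. g i x ^ \<beta> i)) = 0"
  shows "\<forall>\<beta>\<in>M. c \<beta> = 0"
  using irr chain g g0 g1 M rel
proof (induction d arbitrary: M c)
  case 0
  have "Z 0 \<noteq> {}"
    using 0(1)[of 0] by (auto simp: irreducible_closedin_def irreducible_space_def)
  then obtain x where x: "x \<in> Z 0" by blast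
  \<comment> \<open>the only exponent vector on the empty index set is the everywhere undefined one\<close>
  have "M \<subseteq> {\<lambda>_. undefined}" using 0(7) by auto
  then consider "M = {}" | "M = {\<lambda>_. undefined}" by blast
  then show ?case using 0(8)[OF x] by cases auto
next
  case (Suc d)
  show ?case
  proof (rule ccontr)
    assume "\<not> ?case"
    define M1 where "M1 = {\<beta>\<in>M. c \<beta> \<noteq> 0}"
    have M1: "finite M1" "M1 \<noteq> {}" "M1 \<subseteq> {1..Suc d} \<rightarrow>\<^sub>E UNIV"
      using \<open>\<not> ?case\<close> Suc.prems(6,7) by (auto simp: M1_def)
    define e where "e = Min ((\<lambda>\<beta>. \<beta> (Suc d)) ` M1)"
    have e_le: "e \<le> \<beta> (Suc d)" if "\<beta> \<in> M1" for \<beta>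
      unfolding e_def using that M1(1) by auto
    have "e \<in> (\<lambda>\<beta>. \<beta> (Suc d)) ` M1"
      unfolding e_def using M1 by (intro Min_in) auto
    then obtain \<beta>0 where \<beta>0: "\<beta>0 \<in> M1" "\<beta>0 (Suc d) = e" by blast
    define G where "G \<beta> x = (\<Prod>i\<in>{1..d}. g i x ^ \<beta> i)" for \<beta> :: "nat \<Rightarrow> nat" and x
    define Q where "Q x = (\<Sum>\<beta>\<in>M1. c \<beta> * (G \<beta> x * g (Suc d) x ^ (\<beta> (Suc d) - e)))" for x
    have gR: "g i \<in> R" if "i \<in> {1..Suc d}" for i using Suc.prems(3)[OF that] .
    have QR: "Q \<in> R"
      unfolding Q_def G_def
      by (intro function_ring_sum[OF ring] function_ring_mult[OF ring] function_ring_const[OF ring]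
          function_ring_prod[OF ring] function_ring_power[OF ring] gR) auto
    have fac: "g (Suc d) x ^ e * Q x = 0" if x: "x \<in> Z (Suc d)" for x
    proof -
      have "g (Suc d) x ^ e * Q x = (\<Sum>\<beta>\<in>M1. c \<beta> * (\<Prod>i\<in>{1..Suc d}. g i x ^ \<beta> i))"
        unfolding Q_def sum_distrib_left
      proof (rule sum.cong[OF refl])
        fix \<beta> assume "\<beta> \<in> M1"
        then have "g (Suc d) x ^ \<beta> (Suc d) = g (Suc d) x ^ e * g (Suc d) x ^ (\<beta> (Suc d) - e)"
          using e_le by (simp flip: power_add)
        then show "g (Suc d) x ^ e * (c \<beta> * (G \<beta> x * g (Suc d) x ^ (\<beta> (Suc d) - e))) =
            c \<beta> * (\<Prod>i\<in>{1..Suc d}. g i x ^ \<beta> i)"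
          by (simp add: G_def mult_ac)
      qed
      also have "\<dots> = (\<Sum>\<beta>\<in>M. c \<beta> * (\<Prod>i\<in>{1..Suc d}. g i x ^ \<beta> i))"
        by (rule sum.mono_neutral_left) (use Suc.prems(6) in \<open>auto simp: M1_def\<close>)
      finally show ?thesis using Suc.prems(8)[OF x] by simp
    qed
    have Zc: "irreducible_space (subtopology X (Z (Suc d)))" "Z (Suc d) \<subseteq> topspace X"
      using Suc.prems(1)[of "Suc d"] closedin_subset by (auto simp: irreducible_closedin_def)
    have "Z (Suc d) \<subseteq> {x\<in>topspace X. g (Suc d) x = 0} \<or> Z (Suc d) \<subseteq> {x\<in>topspace X. Q x = 0}"
      by (rule irreducible_space_subset_cases[OF Zc closed closed])
         (use fac Zc(2) gR QR in auto)
    then have Q0: "Q x = 0" if "x \<in> Z (Suc d)" for x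
      using Suc.prems(5)[of "Suc d"] that by auto
    \<comment> \<open>the terms surviving on \<open>Z d\<close>; they all agree in the last exponent\<close>
    define M2 where "M2 = {\<beta>\<in>M1. \<beta> (Suc d) = e}"
    let ?r = "\<lambda>\<beta>. restrict \<beta> {1..d}"
    have inj: "inj_on ?r M2"
    proof (rule inj_onI)
      fix \<beta> \<gamma> assume \<beta>: "\<beta> \<in> M2" and \<gamma>: "\<gamma> \<in> M2" and eq: "?r \<beta> = ?r \<gamma>"
      have ext: "\<beta> \<in> extensional {1..Suc d}" "\<gamma> \<in> extensional {1..Suc d}"
        using \<beta> \<gamma> M1(3) by (auto simp: M2_def PiE_def)
      show "\<beta> = \<gamma>"
      proof (rule extensionalityI[OF ext])
        fix i assume "i \<in> {1..Suc d}"
        then consider "i \<in> {1..d}" | "i = Suc d" by fastforce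
        then show "\<beta> i = \<gamma> i"
        proof cases
          case 1
          then show ?thesis using fun_cong[OF eq, of i] by simp
        next
          case 2
          then show ?thesis using \<beta> \<gamma> by (simp add: M2_def)
        qed
      qed
    qed
    define c2 where "c2 = c \<circ> the_inv_into M2 ?r"
    have c2: "c2 (?r \<beta>) = c \<beta>" if "\<beta> \<in> M2" for \<beta>
      unfolding c2_def comp_def by (subst the_inv_into_f_f[OF inj that]) (rule refl)
    have "\<forall>\<beta>\<in>?r ` M2. c2 \<beta> = 0"
    proof (rule Suc.IH)
      show "irreducible_closedin X (Z i)" if "i \<le> d" for i using Suc.prems(1) that by simp
      show "Z i \<subseteq> Z (Suc i)" if "i < d" for i using Suc.prems(2) that by simp
      show "g i \<in> R" if "i \<in> {1..d}" for i using Suc.prems(3) that by simp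
      show "g (Suc i) x = 0" if "i < d" "x \<in> Z i" for i x using Suc.prems(4) that by simp
      show "\<exists>x\<in>Z i. g i x \<noteq> 0" if "i \<in> {1..d}" for i using Suc.prems(5) that by simp
      show "finite (?r ` M2)" using M1(1) by (simp add: M2_def)
      show "?r ` M2 \<subseteq> {1..d} \<rightarrow>\<^sub>E UNIV" by auto
      fix x assume x: "x \<in> Z d"
      have "0 = Q x" using Q0 x Suc.prems(2)[of d] by auto
      also have "\<dots> = (\<Sum>\<beta>\<in>M2. c \<beta> * G \<beta> x)"
        unfolding Q_def
      proof (rule sum.mono_neutral_cong_right)
        show "\<forall>\<beta>\<in>M1 - M2. c \<beta> * (G \<beta> x * g (Suc d) x ^ (\<beta> (Suc d) - e)) = 0"
        proof
          fix \<beta> assume "\<beta> \<in> M1 - M2"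
          then have "\<beta> (Suc d) - e \<noteq> 0" using e_le[of \<beta>] by (auto simp: M2_def)
          then show "c \<beta> * (G \<beta> x * g (Suc d) x ^ (\<beta> (Suc d) - e)) = 0"
            using Suc.prems(4)[of d x] x by simp
        qed
      qed (use M1(1) in \<open>auto simp: M2_def\<close>)
      also have "\<dots> = (\<Sum>\<beta>\<in>?r ` M2. c2 \<beta> * (\<Prod>i\<in>{1..d}. g i x ^ \<beta> i))"
        by (subst sum.reindex[OF inj]) (auto simp: c2 G_def simp del: One_nat_def intro!: sum.cong)
      finally show "(\<Sum>\<beta>\<in>?r ` M2. c2 \<beta> * (\<Prod>i\<in>{1..d}. g i x ^ \<beta> i)) = 0" by simp
    qed
    moreover have "\<beta>0 \<in> M2" using \<beta>0 by (simp add: M2_def)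
    ultimately show False using c2[of \<beta>0] \<beta>0(1) by (auto simp: M1_def)
  qed
qed

text \<open>
  The map \<open>s\<close> assigns parameters to each point; along it a relation between rational functions of
  the parameters becomes a relation between the functions \<open>u\<close>.
\<close>

lemma krull_dim_le:
  fixes R :: "('p \<Rightarrow> 'a::field) set" and s :: "'p \<Rightarrow> nat \<Rightarrow> 'a"
  assumes ring: "function_ring R"
    and closed: "\<And>u. u \<in> R \<Longrightarrow> closedin X {x\<in>topspace X. u x = 0}"
    and separate: "\<And>C x. closedin X C \<Longrightarrow> x \<in> topspace X - C \<Longrightarrow> \<exists>u\<in>R. (\<forall>y\<in>C. u y = 0) \<and> u x \<noteq> 0"
    and rational: "\<And>u. u \<in> R \<Longrightarrow> \<exists>p\<in>mpolys m. \<exists>h\<in>mpolys m.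
      \<forall>x\<in>topspace X. meval h (s x) \<noteq> 0 \<and> u x = meval p (s x) / meval h (s x)"
  shows "krull_dim X \<le> ereal (real m)"
  unfolding krull_dim_def
proof (rule Sup_least, clarify)
  fix d Z
  assume irr: "\<forall>i\<le>d. irreducible_closedin X (Z i)" and chain: "\<forall>i<d. Z i \<subset> Z (Suc i)"
  show "ereal (real d) \<le> ereal (real m)"
  proof (rule ccontr)
    assume "\<not> ?thesis"
    then have md: "m < d" by simp
    have sub: "Z i \<subseteq> topspace X" if "i \<le> d" for i
      using irr that closedin_subset by (auto simp: irreducible_closedin_def)
    have "\<exists>u\<in>R. (\<forall>x\<in>Z (i - 1). u x = 0) \<and> (\<exists>x\<in>Z i. u x \<noteq> 0)" if i: "i \<in> {1..d}" for i
    proof -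
      have "i - 1 < d" "Suc (i - 1) = i" using i by auto
      then have "Z (i - 1) \<subset> Z i" using chain by metis
      then obtain x where x: "x \<in> Z i" "x \<notin> Z (i - 1)" by auto
      have "closedin X (Z (i - 1))"
        using irr \<open>i - 1 < d\<close> by (auto simp: irreducible_closedin_def simp del: One_nat_def)
      then show ?thesis using separate[of "Z (i - 1)" x] x sub[of i] i by auto
    qed
    then obtain g where g: "\<And>i. i \<in> {1..d} \<Longrightarrow>
        g i \<in> R \<and> (\<forall>x\<in>Z (i - 1). g i x = 0) \<and> (\<exists>x\<in>Z i. g i x \<noteq> 0)"
      by metis
    have "\<exists>p h. p \<in> mpolys m \<and> h \<in> mpolys m \<and>
        (\<forall>x\<in>topspace X. meval h (s x) \<noteq> 0 \<and> g i x = meval p (s x) / meval h (s x))"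
      if "i \<in> {1..d}" for i
      using rational g[OF that] by blast
    then obtain p h where ph: "\<And>i. i \<in> {1..d} \<Longrightarrow> p i \<in> mpolys m \<and> h i \<in> mpolys m \<and>
        (\<forall>x\<in>topspace X. meval (h i) (s x) \<noteq> 0 \<and> g i x = meval (p i) (s x) / meval (h i) (s x))"
      by metis
    have "\<exists>M c. finite M \<and> M \<subseteq> {1..d} \<rightarrow>\<^sub>E UNIV \<and> (\<exists>\<beta>\<in>M. c \<beta> \<noteq> 0) \<and>
      (\<forall>t. (\<forall>i\<in>{1..d}. meval (h i) t \<noteq> 0) \<longrightarrow>
        (\<Sum>\<beta>\<in>M. c \<beta> * (\<Prod>i\<in>{1..d}. (meval (p i) t / meval (h i) t) ^ \<beta> i)) = 0)"
      by (rule rational_functions_dependent[OF md]) (simp_all only: ph)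
    then obtain M c where Mc: "finite M" "M \<subseteq> {1..d} \<rightarrow>\<^sub>E UNIV" "\<exists>\<beta>\<in>M. c \<beta> \<noteq> 0"
      and rel: "\<forall>t. (\<forall>i\<in>{1..d}. meval (h i) t \<noteq> 0) \<longrightarrow>
        (\<Sum>\<beta>\<in>M. c \<beta> * (\<Prod>i\<in>{1..d}. (meval (p i) t / meval (h i) t) ^ \<beta> i)) = 0"
      by (elim exE conjE) (rule that)
    have "\<forall>\<beta>\<in>M. c \<beta> = 0"
    proof (rule chain_functions_independent[OF ring closed, where g = g and Z = Z and d = d])
      show "g (Suc i) x = 0" if "i < d" "x \<in> Z i" for i x
        using g[of "Suc i"] that by auto
      fix x assume "x \<in> Z d"
      then have x: "x \<in> topspace X" using sub by blast
      have "(\<Sum>\<beta>\<in>M. c \<beta> * (\<Prod>i\<in>{1..d}. g i x ^ \<beta> i)) =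
          (\<Sum>\<beta>\<in>M. c \<beta> * (\<Prod>i\<in>{1..d}. (meval (p i) (s x) / meval (h i) (s x)) ^ \<beta> i))"
        using ph x by (intro sum.cong refl arg_cong2[where f = "(*)"] prod.cong) auto
      also have "\<dots> = 0" using ph x by (intro rel[rule_format]) simp
      finally show "(\<Sum>\<beta>\<in>M. c \<beta> * (\<Prod>i\<in>{1..d}. g i x ^ \<beta> i)) = 0" .
    qed (use irr chain g Mc in auto)
    with Mc(3) show False by blast
  qed
qed

section \<open>Regular functions on basic open sets\<close>

lemma function_ring_regular:
  assumes f: "f \<in> mpolys n"
  shows "function_ring (regular (basic_open_variety n f))"
  unfolding function_ring_def
proof (intro conjI allI ballI)
  fix c
  show "(\<lambda>_. c) \<in> regular (basic_open_variety n f)"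
    by (auto simp: basic_open_variety_def mpolys_const
        intro!: bexI[of _ "Poly_Mapping.single 0 c"] exI[of _ 0])
next
  fix u v assume "u \<in> regular (basic_open_variety n f)" "v \<in> regular (basic_open_variety n f)"
  then have "\<exists>p\<in>mpolys n. \<exists>k. \<forall>x\<in>basic_open n f. u x = meval p x / meval f x ^ k"
    "\<exists>q\<in>mpolys n. \<exists>l. \<forall>x\<in>basic_open n f. v x = meval q x / meval f x ^ l"
    by (simp_all add: basic_open_variety_def)
  then obtain p k q l where p: "p \<in> mpolys n" "\<And>x. x \<in> basic_open n f \<Longrightarrow> u x = meval p x / meval f x ^ k"
    and q: "q \<in> mpolys n" "\<And>x. x \<in> basic_open n f \<Longrightarrow> v x = meval q x / meval f x ^ l"
    by metis
  have "u x + v x = meval (p * f ^ l + q * f ^ k) x / meval f x ^ (k + l)"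
    and "u x * v x = meval (p * q) x / meval f x ^ (k + l)" if x: "x \<in> basic_open n f" for x
    using x by (auto simp: p(2) q(2) meval_add meval_mult meval_power basic_open_def field_simps power_add)
  then show "(\<lambda>x. u x + v x) \<in> regular (basic_open_variety n f)"
      "(\<lambda>x. u x * v x) \<in> regular (basic_open_variety n f)"
    using mpolys_add[OF mpolys_mult[OF p(1) mpolys_power[OF f]] mpolys_mult[OF q(1) mpolys_power[OF f]]]
      mpolys_mult[OF p(1) q(1)]
    unfolding basic_open_variety_def by auto
qed

lemma regular_coordinate:
  "i \<in> {1..n} \<Longrightarrow> (\<lambda>x. x i) \<in> regular (basic_open_variety n f)"
  by (auto simp: basic_open_variety_def intro!: bexI[of _ "mvar i"] mpolys_mvar exI[of _ 0])

lemma topspace_basic_open_variety [simp]: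
  "topspace (zariski (basic_open_variety n f)) = basic_open n f"
  by (auto simp: basic_open_variety_def basic_open_def)

lemma closedin_regular_zeros:
  assumes "u \<in> regular (basic_open_variety n f)"
  shows "closedin (zariski (basic_open_variety n f)) {x\<in>basic_open n f. u x = 0}"
proof -
  obtain p k where p: "p \<in> mpolys n" "\<And>x. x \<in> basic_open n f \<Longrightarrow> u x = meval p x / meval f x ^ k"
    using assms by (auto simp: basic_open_variety_def)
  have "{x\<in>basic_open n f. u x = 0} = {x\<in>affine_points n. \<forall>p\<in>{p}. meval p x = 0} \<inter> basic_open n f"
    using p(2) by (auto simp: basic_open_def)
  moreover have "closedin (affine_zariski n) {x\<in>affine_points n. \<forall>p\<in>{p}. meval p x = 0}"
    unfolding closedin_affine_zariski using p(1) by (intro exI[of _ "{p}"]) auto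
  ultimately show ?thesis
    by (auto simp: basic_open_variety_def closedin_subtopology)
qed

lemma closedin_regular_common_zeros:
  assumes "\<And>i. i \<in> I \<Longrightarrow> u i \<in> regular (basic_open_variety n f)"
  shows "closedin (zariski (basic_open_variety n f)) {x\<in>basic_open n f. \<forall>i\<in>I. u i x = 0}"
proof -
  have "{x\<in>basic_open n f. \<forall>i\<in>I. u i x = 0} =
      basic_open n f \<inter> (\<Inter>i\<in>I. {x\<in>basic_open n f. u i x = 0})"
    by auto
  also have "\<dots> = \<Inter>(insert (basic_open n f) ((\<lambda>i. {x\<in>basic_open n f. u i x = 0}) ` I))"
    by auto
  also have "closedin (zariski (basic_open_variety n f)) \<dots>"
    using assms closedin_regular_zeros closedin_topspace[of "zariski (basic_open_variety n f)"]
    by (intro closedin_Inter) auto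
  finally show ?thesis .
qed

lemma closedin_basic_open_separate:
  assumes "closedin (zariski (basic_open_variety n f)) C" "x \<in> basic_open n f" "x \<notin> C"
  shows "\<exists>p\<in>mpolys n. (\<forall>y\<in>C. meval p y = 0) \<and> meval p x \<noteq> 0"
proof -
  obtain T where T: "closedin (affine_zariski n) T" "C = T \<inter> basic_open n f"
    using assms(1) by (auto simp: basic_open_variety_def closedin_subtopology)
  then obtain S where S: "S \<subseteq> mpolys n" "T = {x\<in>affine_points n. \<forall>p\<in>S. meval p x = 0}"
    unfolding closedin_affine_zariski by blast
  have "x \<in> affine_points n" using assms(2) by (simp add: basic_open_def)
  then obtain p where "p \<in> S" "meval p x \<noteq> 0"
    using assms(2,3) T(2) S(2) by blast
  then show ?thesis using S T(2) by blast
qed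


lemma function_ring_univariate: "function_ring (range (poly :: 'a::comm_ring_1 poly \<Rightarrow> 'a \<Rightarrow> 'a))"
  unfolding function_ring_def
proof (intro conjI allI ballI)
  fix c :: 'a
  show "(\<lambda>_. c) \<in> range poly" by (rule range_eqI[of _ _ "[:c:]"]) auto
next
  fix u v :: "'a \<Rightarrow> 'a" assume "u \<in> range poly" "v \<in> range poly"
  then obtain p q where pq: "u = poly p" "v = poly q" by blast
  show "(\<lambda>x. u x + v x) \<in> range poly"
    by (rule range_eqI[of _ _ "p + q"]) (simp add: pq fun_eq_iff)
  show "(\<lambda>x. u x * v x) \<in> range poly"
    by (rule range_eqI[of _ _ "p * q"]) (simp add: pq fun_eq_iff)
qed

lemma meval_line:
  fixes p :: "'a::comm_ring_1 mpoly"
  assumes "p \<in> mpolys n"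
  shows "\<exists>P. \<forall>t. poly P t = meval p (\<lambda>i. x i + t * (y i - x i))"
proof -
  have "(\<lambda>t. x i + t * (y i - x i)) \<in> range poly" for i
    by (rule range_eqI[of _ _ "[:x i, y i - x i:]"]) (auto simp: fun_eq_iff)
  then have "(\<lambda>t. meval p (\<lambda>i. x i + t * (y i - x i))) \<in> range poly"
    by (intro function_ring_meval[OF function_ring_univariate assms])
  then obtain P where "(\<lambda>t. meval p (\<lambda>i. x i + t * (y i - x i))) = poly P" by auto
  then show ?thesis by (intro exI[of _ P]) (simp add: fun_eq_iff)
qed

text \<open>
  If \<open>W\<close> were the union of two proper closed subsets, one polynomial would vanish on the first but
  not at some \<open>x\<close>, another on the second but not at some \<open>y\<close>. On the line through \<open>x\<close> and \<open>y\<close>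
  both, and \<open>f\<close> too, become nonzero one-variable polynomials, so that some point of the line avoids
  all their zeros. That point lies in \<open>W\<close> but in neither of the two closed subsets.
\<close>

lemma irreducible_space_line_closed:
  fixes f :: "'a::field_char_0 mpoly"
  assumes f: "f \<in> mpolys n" and W: "W \<subseteq> basic_open n f" "W \<noteq> {}"
    and line: "\<And>x y t. x \<in> W \<Longrightarrow> y \<in> W \<Longrightarrow> (\<lambda>i. x i + t * (y i - x i)) \<in> basic_open n f \<Longrightarrow>
      (\<lambda>i. x i + t * (y i - x i)) \<in> W"
  shows "irreducible_space (subtopology (zariski (basic_open_variety n f)) W)"
  unfolding irreducible_space_def
proof (intro conjI allI impI)
  let ?X = "zariski (basic_open_variety n f)"
  have top: "topspace (subtopology ?X W) = W" using W(1) by auto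
  then show "topspace (subtopology ?X W) \<noteq> {}" using W(2) by simp
  fix C C' assume CC: "closedin (subtopology ?X W) C \<and> closedin (subtopology ?X W) C' \<and>
    C \<union> C' = topspace (subtopology ?X W)"
  show "C = topspace (subtopology ?X W) \<or> C' = topspace (subtopology ?X W)"
  proof (rule ccontr)
    assume "\<not> ?thesis"
    then obtain x y where xy: "x \<in> W" "x \<notin> C" "y \<in> W" "y \<notin> C'"
      using CC top by blast
    obtain T T' where T: "closedin ?X T" "C = T \<inter> W" "closedin ?X T'" "C' = T' \<inter> W"
      using CC by (auto simp: closedin_subtopology)
    obtain p where p: "p \<in> mpolys n" "\<forall>z\<in>T. meval p z = 0" "meval p x \<noteq> 0"
      using closedin_basic_open_separate[OF T(1), of x] xy T(2) W(1) by blast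
    obtain q where q: "q \<in> mpolys n" "\<forall>z\<in>T'. meval q z = 0" "meval q y \<noteq> 0"
      using closedin_basic_open_separate[OF T(3), of y] xy T(4) W(1) by blast
    let ?l = "\<lambda>t i. x i + t * (y i - x i)"
    obtain P Q F where P: "\<And>t. poly P t = meval p (?l t)" and Q: "\<And>t. poly Q t = meval q (?l t)"
      and F: "\<And>t. poly F t = meval f (?l t)"
      using meval_line[OF p(1), of x y] meval_line[OF q(1), of x y] meval_line[OF f, of x y] by metis
    have "poly P 0 \<noteq> 0" "poly Q 1 \<noteq> 0" "poly F 0 \<noteq> 0"
      using p(3) q(3) xy(1) W(1) by (auto simp: P Q F basic_open_def)
    then have "P * Q * F \<noteq> 0" by auto
    then have "finite {t. poly (P * Q * F) t = 0}" by (rule poly_roots_finite)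
    then obtain t where "poly (P * Q * F) t \<noteq> 0"
      using infinite_UNIV_char_0 ex_new_if_finite[of "{t. poly (P * Q * F) t = 0}"] by blast
    then have t: "meval p (?l t) \<noteq> 0" "meval q (?l t) \<noteq> 0" "meval f (?l t) \<noteq> 0"
      by (auto simp: P Q F)
    have "x \<in> affine_points n" "y \<in> affine_points n"
      using xy W(1) by (auto simp: basic_open_def)
    then have "?l t \<in> affine_points n"
      by (auto simp: affine_points_def PiE_def extensional_def)
    then have "?l t \<in> W" using line[OF xy(1,3)] t(3) by (simp add: basic_open_def)
    then have "?l t \<in> T \<or> ?l t \<in> T'" using CC top T by blast
    then show False using p(2) q(2) t by blast
  qed
qed

lemma mpolys_discrim: "discrim n \<in> mpolys n"
  unfolding discrim_def by (intro mpolys_prod) (auto intro!: mpolys_diff mpolys_mvar)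

lemma meval_discrim:
  "meval (discrim n) x = (\<Prod>(i, j)\<in>{(i, j). i \<in> {1..n} \<and> j \<in> {1..n} \<and> i \<noteq> j}. x i - x j)"
  by (simp only: discrim_def meval_prod case_prod_unfold meval_diff meval_mvar)

text \<open>Each \<open>x i - x j\<close> is a factor of the discriminant, which is invertible.\<close>

lemma regular_inverse_diff:
  fixes i j :: nat
  assumes ij: "i \<in> {1..n}" "j \<in> {1..n}" "i \<noteq> j"
  shows "(\<lambda>x. 1 / (x i - x j)) \<in> regular (basic_open_variety n (discrim n :: 'a::field mpoly))"
proof -
  let ?I = "{(i, j). i \<in> {1..n} \<and> j \<in> {1..n} \<and> i \<noteq> j}"
  define r where "r = (\<Prod>(i, j)\<in>?I - {(i, j)}. mvar i - mvar j :: 'a mpoly)"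
  have fin: "finite ?I" by (rule finite_subset[of _ "{1..n} \<times> {1..n}"]) auto
  have "(i, j) \<in> ?I" using ij by simp
  then have "discrim n = (mvar i - mvar j) * r"
    unfolding discrim_def r_def by (rule prod.remove[OF fin, THEN trans]) simp
  then have d: "meval (discrim n) x = (x i - x j) * meval r x" for x
    by (simp add: meval_mult meval_diff)
  have "r \<in> mpolys n"
    unfolding r_def by (intro mpolys_prod) (auto intro!: mpolys_diff mpolys_mvar)
  moreover have "1 / (x i - x j) = meval r x / meval (discrim n) x ^ 1"
    if "x \<in> basic_open n (discrim n)" for x
    using that by (simp add: basic_open_def d)
  ultimately have "\<exists>p\<in>mpolys n. \<exists>m. \<forall>x\<in>basic_open n (discrim n :: 'a mpoly).
      1 / (x i - x j) = meval p x / meval (discrim n) x ^ m"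
    by (intro bexI[of _ r] exI[of _ 1] ballI)
  then show ?thesis
    by (simp add: basic_open_variety_def)
qed

lemma discrim_permute:
  assumes "\<sigma> permutes {1..n}"
  shows "meval (discrim n) (x \<circ> \<sigma>) = meval (discrim n) x"
proof -
  let ?I = "{(i, j). i \<in> {1..n} \<and> j \<in> {1..n} \<and> i \<noteq> j}"
  have \<sigma>: "\<sigma> i \<in> {1..n}" "inv \<sigma> i \<in> {1..n}" if "i \<in> {1..n}" for i
    using that permutes_in_image[OF assms] permutes_in_image[OF permutes_inv[OF assms]] by blast+
  have inj: "\<sigma> i = \<sigma> j \<longleftrightarrow> i = j" "inv \<sigma> i = inv \<sigma> j \<longleftrightarrow> i = j" for i j
    by (simp_all only: inj_eq[OF permutes_inj[OF assms]] inj_eq[OF permutes_inj[OF permutes_inv[OF assms]]])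
  have "bij_betw (\<lambda>(i, j). (\<sigma> i, \<sigma> j)) ?I ?I"
    by (rule bij_betw_byWitness[where f' = "\<lambda>(i, j). (inv \<sigma> i, inv \<sigma> j)"])
       (use \<sigma> in \<open>auto simp: permutes_inverses[OF assms] inj simp del: atLeastAtMost_iff\<close>)
  then show ?thesis
    unfolding meval_discrim
    by (intro prod.reindex_bij_betw[of "\<lambda>(i, j). (\<sigma> i, \<sigma> j)" ?I ?I "\<lambda>(i, j). x i - x j", THEN trans[rotated]])
       (auto simp: case_prod_unfold)
qed

lemma basic_open_permute:
  assumes "x \<in> basic_open n (discrim n)" "\<sigma> permutes {1..n}"
  shows "x \<circ> \<sigma> \<in> basic_open n (discrim n)"
proof -
  have "x (\<sigma> i) = undefined" if "i \<notin> {1..n}" for i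
    using assms that permutes_not_in[OF assms(2) that]
    by (auto simp: basic_open_def affine_points_def PiE_def extensional_def)
  then show ?thesis
    using assms(1) discrim_permute[OF assms(2), of x]
    by (auto simp: basic_open_def affine_points_def PiE_def extensional_def)
qed

lemma regular_permute:
  assumes "u \<in> regular (basic_open_variety n (discrim n))" "\<sigma> permutes {1..n}"
  shows "(\<lambda>x. u (x \<circ> \<sigma>)) \<in> regular (basic_open_variety n (discrim n :: 'a::field mpoly))"
proof -
  obtain p k where p: "p \<in> mpolys n"
      "\<And>x. x \<in> basic_open n (discrim n) \<Longrightarrow> u x = meval p x / meval (discrim n) x ^ k"
    using assms(1) by (auto simp: basic_open_variety_def)
  have "(\<lambda>x. meval p (\<lambda>i. x (\<sigma> i))) \<in> poly_funs n"
    using permutes_in_image[OF assms(2)]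
    by (intro function_ring_meval[OF function_ring_poly_funs p(1)] poly_funs_coordinate) blast
  then obtain p' where p': "p' \<in> mpolys n" "(\<lambda>x. meval p (\<lambda>i. x (\<sigma> i))) = meval p'"
    by (auto simp: poly_funs_def)
  have "u (x \<circ> \<sigma>) = meval p' x / meval (discrim n) x ^ k" if x: "x \<in> basic_open n (discrim n)" for x
    using p(2)[OF basic_open_permute[OF x assms(2)]] fun_cong[OF p'(2), of x]
      discrim_permute[OF assms(2), of x] by (simp add: comp_def)
  then show ?thesis
    using p'(1) unfolding basic_open_variety_def by auto
qed

section \<open>Quotients with a slice\<close>

lemma geometric_quotient_geometric_quotient:
  "geometric_quotient (geometric_quotient V q) r = geometric_quotient V (r \<circ> q)"
proof -
  have "{x\<in>topspace X. q x \<in> {y\<in>q ` topspace X. r y \<in> U}} = {x\<in>topspace X. (r \<circ> q) x \<in> U}"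
    for X U by auto
  then have "quotient_topology (quotient_topology X q) r = quotient_topology X (r \<circ> q)" for X
    by (simp add: topology_eq openin_quotient_topology image_comp subset_iff)
  then show ?thesis by (simp add: geometric_quotient_def comp_assoc)
qed

text \<open>
  \<open>N\<close> retracts the tuples onto a slice, and the permutations account for the identifications made
  within the slice: \<open>N_absorb\<close> says that \<open>x \<mapsto> N (x \<circ> \<sigma>)\<close> defines an action of
  the symmetric group on the slice, and \<open>q_eq_iff\<close> that its orbits are the fibres of \<open>q\<close>.
\<close>

locale slice_quotient =
  fixes n :: nat and q :: "(nat \<Rightarrow> 'a::field_char_0) \<Rightarrow> 'q" and N :: "(nat \<Rightarrow> 'a) \<Rightarrow> (nat \<Rightarrow> 'a)"
  assumes N_in: "x \<in> basic_open n (discrim n) \<Longrightarrow> N x \<in> basic_open n (discrim n)"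
    and N_regular: "i \<in> {1..n} \<Longrightarrow> (\<lambda>x. N x i) \<in> regular (basic_open_variety n (discrim n))"
    and N_absorb: "x \<in> basic_open n (discrim n) \<Longrightarrow> \<sigma> permutes {1..n} \<Longrightarrow> N (N x \<circ> \<sigma>) = N (x \<circ> \<sigma>)"
    and q_eq_iff: "x \<in> basic_open n (discrim n) \<Longrightarrow> y \<in> basic_open n (discrim n) \<Longrightarrow>
      q x = q y \<longleftrightarrow> (\<exists>\<sigma>. \<sigma> permutes {1..n} \<and> N y = N (x \<circ> \<sigma>))"
begin

abbreviation tuples :: "(nat \<Rightarrow> 'a) set"
  where "tuples \<equiv> basic_open n (discrim n)"

abbreviation tuple_variety :: "(nat \<Rightarrow> 'a, 'a) variety"
  where "tuple_variety \<equiv> basic_open_variety n (discrim n)"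

abbreviation quotient :: "('q, 'a) variety"
  where "quotient \<equiv> geometric_quotient tuple_variety q"

lemma N_idem: "x \<in> tuples \<Longrightarrow> N (N x) = N x"
  using N_absorb[of x id] by (simp add: permutes_id)

lemma q_N: "x \<in> tuples \<Longrightarrow> q (N x) = q x"
  using q_eq_iff[of x "N x"] N_in N_idem by (auto intro!: exI[of _ id] simp: permutes_def)

lemma topspace_quotient [simp]: "topspace (zariski quotient) = q ` tuples"
  by (simp add: geometric_quotient_def)

lemma continuous_q: "continuous_map (zariski tuple_variety) (zariski quotient) q"
  by (simp add: geometric_quotient_def quotient_imp_continuous_map quotient_map_quotient_topology)

lemma closedin_quotient_iff:
  assumes "C \<subseteq> q ` tuples"
  shows "closedin (zariski quotient) C \<longleftrightarrow> closedin (zariski tuple_variety) {x\<in>tuples. q x \<in> C}"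
  using assms quotient_map_quotient_topology[of "zariski tuple_variety" q]
  by (simp add: geometric_quotient_def quotient_map_closedin)

lemma function_ring_tuples: "function_ring (regular tuple_variety)"
  by (rule function_ring_regular[OF mpolys_discrim])

lemma function_ring_quotient: "function_ring (regular quotient)"
  using function_ring_tuples by (simp add: function_ring_def geometric_quotient_def comp_def)

lemma closedin_quotient_zeros:
  assumes "u \<in> regular quotient"
  shows "closedin (zariski quotient) {y\<in>topspace (zariski quotient). u y = 0}"
proof -
  have "{x\<in>tuples. q x \<in> {y\<in>q ` tuples. u y = 0}} = {x\<in>tuples. (u \<circ> q) x = 0}" by auto
  moreover have "u \<circ> q \<in> regular tuple_variety"
    using assms by (simp add: geometric_quotient_def)
  ultimately have "closedin (zariski tuple_variety) {x\<in>tuples. q x \<in> {y\<in>q ` tuples. u y = 0}}"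
    using closedin_regular_zeros by metis
  then show ?thesis
    by (subst closedin_quotient_iff) auto
qed

lemma regular_meval_N:
  assumes "p \<in> mpolys n" "\<sigma> permutes {1..n}"
  shows "(\<lambda>x. meval p (N (x \<circ> \<sigma>))) \<in> regular tuple_variety"
  by (rule function_ring_meval[OF function_ring_tuples assms(1), of "\<lambda>i x. N (x \<circ> \<sigma>) i"])
    (rule regular_permute[OF N_regular assms(2)])

text \<open>This is the continuity of \<open>x \<mapsto> N (x \<circ> \<sigma>)\<close>.\<close>

lemma closedin_slice_preimage:
  assumes "\<sigma> permutes {1..n}" and "closedin (zariski tuple_variety) W"
  shows "closedin (zariski tuple_variety) {x\<in>tuples. N (x \<circ> \<sigma>) \<in> W}"
proof -
  define S where "S = {p\<in>mpolys n. \<forall>y\<in>W. meval p y = 0}"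
  have W: "W \<subseteq> tuples" using closedin_subset[OF assms(2)] by simp
  have "N (x \<circ> \<sigma>) \<in> W \<longleftrightarrow> (\<forall>p\<in>S. meval p (N (x \<circ> \<sigma>)) = 0)" if x: "x \<in> tuples" for x
    using closedin_basic_open_separate[OF assms(2), of "N (x \<circ> \<sigma>)"]
      N_in[OF basic_open_permute[OF x assms(1)]] by (auto simp: S_def)
  then have "{x\<in>tuples. N (x \<circ> \<sigma>) \<in> W} = {x\<in>tuples. \<forall>p\<in>S. meval p (N (x \<circ> \<sigma>)) = 0}" by auto
  also have "closedin (zariski tuple_variety) \<dots>"
    using regular_meval_N[OF _ assms(1)] by (intro closedin_regular_common_zeros) (auto simp: S_def)
  finally show ?thesis .
qed

lemma finite_tuple_permutations: "finite {\<sigma>. \<sigma> permutes {1..n}}"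
  by (rule finite_permutations) simp

text \<open>
  For \<open>W\<close> inside the slice, the saturation of \<open>W\<close> is the union of the preimages of \<open>W\<close> under the
  finitely many maps \<open>x \<mapsto> N (x \<circ> \<sigma>)\<close>.
\<close>

lemma closedin_q_image:
  assumes W: "closedin (zariski tuple_variety) W" and fixed: "\<And>x. x \<in> W \<Longrightarrow> N x = x"
  shows "closedin (zariski quotient) (q ` W)"
proof -
  have sub: "W \<subseteq> tuples" using closedin_subset[OF W] by simp
  have "{x\<in>tuples. q x \<in> q ` W} = (\<Union>\<sigma>\<in>{\<sigma>. \<sigma> permutes {1..n}}. {x\<in>tuples. N (x \<circ> \<sigma>) \<in> W})"
  proof (intro equalityI subsetI)
    fix x assume "x \<in> {x\<in>tuples. q x \<in> q ` W}"
    then obtain w where x: "x \<in> tuples" "w \<in> W" "q x = q w" by auto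
    then obtain \<sigma> where "\<sigma> permutes {1..n}" "N w = N (x \<circ> \<sigma>)"
      using q_eq_iff[of x w] sub by blast
    then show "x \<in> (\<Union>\<sigma>\<in>{\<sigma>. \<sigma> permutes {1..n}}. {x\<in>tuples. N (x \<circ> \<sigma>) \<in> W})"
      using fixed x by auto
  next
    fix x assume "x \<in> (\<Union>\<sigma>\<in>{\<sigma>. \<sigma> permutes {1..n}}. {x\<in>tuples. N (x \<circ> \<sigma>) \<in> W})"
    then obtain \<sigma> where x: "x \<in> tuples" "\<sigma> permutes {1..n}" "N (x \<circ> \<sigma>) \<in> W" by auto
    then have "q x = q (N (x \<circ> \<sigma>))"
      using q_eq_iff[of x "N (x \<circ> \<sigma>)"] fixed sub by auto
    then show "x \<in> {x\<in>tuples. q x \<in> q ` W}" using x by auto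
  qed
  also have "closedin (zariski tuple_variety) \<dots>"
    using closedin_slice_preimage[OF _ W] finite_tuple_permutations by (intro closedin_Union) auto
  finally show ?thesis
    using closedin_quotient_iff[of "q ` W"] sub by auto
qed

lemma irreducible_q_image:
  assumes "irreducible_space (subtopology (zariski tuple_variety) W)" "W \<subseteq> tuples"
  shows "irreducible_space (subtopology (zariski quotient) (q ` W))"
proof (rule irreducible_space_image[OF assms(1)])
  show "continuous_map (subtopology (zariski tuple_variety) W) (subtopology (zariski quotient) (q ` W)) q"
    using continuous_q assms(2)
    by (auto simp: continuous_map_in_subtopology intro: continuous_map_from_subtopology)
  show "q ` topspace (subtopology (zariski tuple_variety) W) = topspace (subtopology (zariski quotient) (q ` W))"
    using assms(2) by auto
qed

text \<open>
  If \<open>W\<close> and \<open>W'\<close> have the same image, then \<open>W'\<close> is covered by the preimages of \<open>W\<close> under the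
  maps \<open>x \<mapsto> N (x \<circ> \<sigma>)\<close>, and irreducibility leaves a single \<open>\<sigma>\<close>. This map sends \<open>W'\<close> into \<open>W\<close>,
  a part of \<open>W'\<close>, so all its iterates do. Some iterate is the identity on the slice because
  \<open>\<sigma>\<close> has finite order.
\<close>

lemma q_image_subset_imp_subset:
  assumes W: "closedin (zariski tuple_variety) W" "\<And>x. x \<in> W \<Longrightarrow> N x = x"
    and W': "W' \<subseteq> tuples" "\<And>x. x \<in> W' \<Longrightarrow> N x = x" "irreducible_space (subtopology (zariski tuple_variety) W')"
    and "W \<subseteq> W'" "q ` W' \<subseteq> q ` W"
  shows "W' \<subseteq> W"
proof -
  have sub: "W \<subseteq> tuples" using closedin_subset[OF W(1)] by simp
  have "W' \<subseteq> (\<Union>\<sigma>\<in>{\<sigma>. \<sigma> permutes {1..n}}. {x\<in>tuples. N (x \<circ> \<sigma>) \<in> W})"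
  proof
    fix x assume x: "x \<in> W'"
    then obtain w where w: "w \<in> W" "q x = q w" using assms(7) by blast
    then obtain \<sigma> where "\<sigma> permutes {1..n}" "N w = N (x \<circ> \<sigma>)"
      using q_eq_iff[of x w] sub W'(1) x by blast
    then show "x \<in> (\<Union>\<sigma>\<in>{\<sigma>. \<sigma> permutes {1..n}}. {x\<in>tuples. N (x \<circ> \<sigma>) \<in> W})"
      using W(2) w x W'(1) by auto
  qed
  then obtain \<sigma> where \<sigma>: "\<sigma> permutes {1..n}" "W' \<subseteq> {x\<in>tuples. N (x \<circ> \<sigma>) \<in> W}"
    using irreducible_space_finite_cover[OF W'(3) _ finite_tuple_permutations, of "\<lambda>\<sigma>. {x\<in>tuples. N (x \<circ> \<sigma>) \<in> W}"]
      closedin_slice_preimage[OF _ W(1)] W'(1) by auto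
  have "permutation \<sigma>" using \<sigma>(1) by (auto simp: permutation_permutes)
  then obtain k where k: "\<sigma> ^^ k = id" "k > 0" using permutation_is_nilpotent by blast
  have pk: "(\<sigma> ^^ j) permutes {1..n}" for j
  proof (induction j)
    case (Suc j)
    then show ?case
      unfolding funpow.simps by (rule permutes_compose[OF _ \<sigma>(1)])
  qed (simp add: permutes_def)
  show ?thesis
  proof
    fix x assume x: "x \<in> W'"
    have "N (x \<circ> \<sigma> ^^ Suc j) \<in> W" for j
    proof (induction j)
      case 0
      then show ?case using subsetD[OF \<sigma>(2) x] by (simp add: comp_def)
    next
      case (Suc j)
      let ?y = "x \<circ> \<sigma> ^^ Suc j"
      have y: "?y \<in> tuples" using basic_open_permute[OF _ pk] x W'(1) by blast
      have "N ?y \<in> W'" using Suc assms(6) by blast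
      then have "N (N ?y \<circ> \<sigma>) \<in> W" using \<sigma>(2) by blast
      then have "N (?y \<circ> \<sigma>) \<in> W" using N_absorb[OF y \<sigma>(1)] by simp
      then show ?case by (simp only: comp_assoc funpow_Suc_right)
    qed
    from this[of "k - 1"] show "x \<in> W" using k W'(2)[OF x] by simp
  qed
qed

lemma krull_dim_ge:
  assumes W: "\<And>i. i \<le> d \<Longrightarrow> closedin (zariski tuple_variety) (W i)"
    "\<And>i. i \<le> d \<Longrightarrow> irreducible_space (subtopology (zariski tuple_variety) (W i))"
    "\<And>i x. i \<le> d \<Longrightarrow> x \<in> W i \<Longrightarrow> N x = x"
    and chain: "\<And>i. i < d \<Longrightarrow> W i \<subset> W (Suc i)"
    and S: "q ` W d \<subseteq> S"
  shows "ereal (real d) \<le> krull_dim (subtopology (zariski quotient) S)"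
proof (rule krull_dim_geI)
  have sub: "W i \<subseteq> tuples" if "i \<le> d" for i
    using closedin_subset[OF W(1)[OF that]] by simp
  have "W i \<subseteq> W d" if "i \<le> d" for i
    using that by (induction rule: inc_induct) (use chain in auto)
  then show "irreducible_closedin (subtopology (zariski quotient) S) (q ` W i)" if "i \<le> d" for i
    using that S W sub closedin_q_image[of "W i"] irreducible_q_image[of "W i"]
    by (intro irreducible_closedin_subtopology) (auto simp: irreducible_closedin_def)
  fix i assume i: "i < d"
  have "\<not> q ` W (Suc i) \<subseteq> q ` W i"
  proof
    assume "q ` W (Suc i) \<subseteq> q ` W i"
    then have "W (Suc i) \<subseteq> W i"
      using W[of i] W(2)[of "Suc i"] W(3)[of "Suc i"] sub[of "Suc i"] chain[OF i] i
      by (intro q_image_subset_imp_subset[of "W i" "W (Suc i)"]) simp_all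
    then show False using chain[OF i] by auto
  qed
  then show "q ` W i \<subset> q ` W (Suc i)" using chain[OF i] by auto
qed

text \<open>
  A polynomial \<open>p\<close> vanishing on the preimage of \<open>C\<close> but not at \<open>N x\<close> need not be invariant. Symmetric
  expressions in the values \<open>p (N (z \<circ> \<sigma>))\<close> are. The product of all \<open>1 - p (N (z \<circ> \<sigma>)) / v\<close>, where
  \<open>v\<close> runs through the nonzero values taken for \<open>z = x\<close>, is \<open>1\<close> when \<open>q z\<close> lies in \<open>C\<close> and \<open>0\<close>
  for \<open>z = x\<close>, since \<open>p (N x)\<close> is one of these \<open>v\<close>; subtract it from \<open>1\<close>.
\<close>

lemma regular_functions_separate:
  assumes C: "closedin (zariski quotient) C" and y: "y \<in> topspace (zariski quotient) - C"
  shows "\<exists>u\<in>regular quotient. (\<forall>z\<in>C. u z = 0) \<and> u y \<noteq> 0"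
proof -
  have CD: "C \<subseteq> q ` tuples" using closedin_subset[OF C] by simp
  obtain x where x: "x \<in> tuples" "q x = y" using y by auto
  let ?Perm = "{\<sigma>. \<sigma> permutes {1..n}}"
  have "closedin (zariski tuple_variety) {x\<in>tuples. q x \<in> C}"
    using C closedin_quotient_iff[OF CD] by simp
  moreover have "N x \<in> tuples" "N x \<notin> {x\<in>tuples. q x \<in> C}"
    using N_in q_N x y by auto
  ultimately obtain p where p: "p \<in> mpolys n" "\<And>z. z \<in> tuples \<Longrightarrow> q z \<in> C \<Longrightarrow> meval p z = 0"
      "meval p (N x) \<noteq> 0"
    using closedin_basic_open_separate[of n "discrim n"] by blast
  define V where "V = (\<lambda>\<sigma>. meval p (N (x \<circ> \<sigma>))) ` ?Perm - {0}"
  define F where "F z = 1 - (\<Prod>\<sigma>\<in>?Perm. \<Prod>v\<in>V. 1 - meval p (N (z \<circ> \<sigma>)) * (1 / v))" for z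
  have F_reg: "F \<in> regular tuple_variety"
    unfolding F_def using regular_meval_N[OF p(1)]
    by (intro function_ring_diff[OF function_ring_tuples] function_ring_const[OF function_ring_tuples]
        function_ring_prod[OF function_ring_tuples] function_ring_mult[OF function_ring_tuples]) auto
  have F_inv: "F z = F z'" if z: "z \<in> tuples" "z' \<in> tuples" "q z = q z'" for z z'
  proof -
    obtain \<tau> where \<tau>: "\<tau> permutes {1..n}" "N z' = N (z \<circ> \<tau>)" using q_eq_iff z by blast
    have "N (z' \<circ> \<sigma>) = N (z \<circ> (\<tau> \<circ> \<sigma>))" if "\<sigma> \<in> ?Perm" for \<sigma>
    proof -
      have "N (z' \<circ> \<sigma>) = N (N (z \<circ> \<tau>) \<circ> \<sigma>)" using N_absorb[OF z(2), of \<sigma>] that \<tau>(2) by simp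
      also have "\<dots> = N (z \<circ> \<tau> \<circ> \<sigma>)"
        using N_absorb[OF basic_open_permute[OF z(1) \<tau>(1)], of \<sigma>] that by simp
      finally show ?thesis by (simp add: comp_assoc)
    qed
    then have "(\<Prod>\<sigma>\<in>?Perm. \<Prod>v\<in>V. 1 - meval p (N (z' \<circ> \<sigma>)) * (1 / v)) =
        (\<Prod>\<sigma>\<in>?Perm. \<Prod>v\<in>V. 1 - meval p (N (z \<circ> (\<tau> \<circ> \<sigma>))) * (1 / v))"
      by (intro prod.cong refl) auto
    also have "\<dots> = (\<Prod>\<sigma>\<in>?Perm. \<Prod>v\<in>V. 1 - meval p (N (z \<circ> \<sigma>)) * (1 / v))"
    proof (rule prod.reindex_bij_betw)
      show "bij_betw ((\<circ>) \<tau>) ?Perm ?Perm"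
        by (rule bij_betw_byWitness[where f' = "(\<circ>) (inv \<tau>)"])
           (use permutes_compose[OF _ \<tau>(1)] permutes_compose[OF _ permutes_inv[OF \<tau>(1)]] in
             \<open>auto simp: fun_eq_iff permutes_inverses[OF \<tau>(1)]\<close>)
    qed
    finally show ?thesis by (simp add: F_def)
  qed
  define u where "u w = F (SOME z. z \<in> tuples \<and> q z = w)" for w
  have u: "u (q z) = F z" if "z \<in> tuples" for z
  proof -
    have "(SOME z'. z' \<in> tuples \<and> q z' = q z) \<in> tuples \<and> q (SOME z'. z' \<in> tuples \<and> q z' = q z) = q z"
      using that by (intro someI[of "\<lambda>z'. z' \<in> tuples \<and> q z' = q z"]) auto
    then show ?thesis unfolding u_def using F_inv that by blast
  qed
  have "u \<in> regular quotient"
    using F_reg u by (simp add: geometric_quotient_def basic_open_variety_def)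
  moreover have "u w = 0" if w: "w \<in> C" for w
  proof -
    obtain z where z: "z \<in> tuples" "w = q z" using CD w by auto
    have "meval p (N (z \<circ> \<sigma>)) = 0" if \<sigma>: "\<sigma> \<in> ?Perm" for \<sigma>
    proof (rule p(2))
      have zs: "z \<circ> \<sigma> \<in> tuples" using basic_open_permute z(1) \<sigma> by auto
      then show "N (z \<circ> \<sigma>) \<in> tuples" by (rule N_in)
      have "q z = q (z \<circ> \<sigma>)" using q_eq_iff[OF z(1) zs] \<sigma> by auto
      then show "q (N (z \<circ> \<sigma>)) \<in> C" using q_N[OF zs] w z(2) by simp
    qed
    then have "F z = 0" by (simp add: F_def)
    then show ?thesis using u z by simp
  qed
  moreover have "u y \<noteq> 0"
  proof -
    have id: "id \<in> ?Perm" by (simp add: permutes_id)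
    have "meval p (N (x \<circ> id)) \<in> V" unfolding V_def using p(3) by (intro DiffI imageI id) simp
    moreover have "finite V" unfolding V_def using finite_tuple_permutations by auto
    ultimately have "(\<Prod>v\<in>V. 1 - meval p (N (x \<circ> id)) * (1 / v)) = 0"
      using p(3) by (intro prod_zero) auto
    then have "(\<Prod>\<sigma>\<in>?Perm. \<Prod>v\<in>V. 1 - meval p (N (x \<circ> \<sigma>)) * (1 / v)) = 0"
      using id by (intro prod_zero[OF finite_tuple_permutations] bexI[of _ id])
    then show ?thesis using u[OF x(1)] x(2) by (simp add: F_def)
  qed
  ultimately show ?thesis by blast
qed

lemma krull_dim_le_parametrization:
  fixes \<psi> :: "(nat \<Rightarrow> 'a) \<Rightarrow> nat \<Rightarrow> 'a"
  assumes \<psi>: "\<And>i. i \<in> {1..n} \<Longrightarrow> (\<lambda>t. \<psi> t i) \<in> poly_funs m"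
    and surj: "\<And>y. y \<in> S \<Longrightarrow> \<exists>t. \<psi> t \<in> tuples \<and> q (\<psi> t) = y"
  shows "krull_dim (subtopology (zariski quotient) S) \<le> ereal (real m)"
proof -
  define s where "s y = (SOME t. \<psi> t \<in> tuples \<and> q (\<psi> t) = y)" for y
  let ?X = "subtopology (zariski quotient) S"
  have top: "topspace ?X = S" using surj by force
  have closed: "closedin ?X {x\<in>topspace ?X. u x = 0}" if "u \<in> regular quotient" for u
    using closedin_quotient_zeros[OF that]
    by (auto simp: closedin_subtopology intro!: exI[of _ "{y\<in>topspace (zariski quotient). u y = 0}"])
  have sep: "\<exists>u\<in>regular quotient. (\<forall>z\<in>C. u z = 0) \<and> u y \<noteq> 0"
    if "closedin ?X C" "y \<in> topspace ?X - C" for C y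
  proof -
    obtain T where T: "closedin (zariski quotient) T" "C = T \<inter> S"
      using \<open>closedin ?X C\<close> by (auto simp: closedin_subtopology)
    then show ?thesis using regular_functions_separate[OF T(1), of y] that(2) by auto
  qed
  have rational: "\<exists>p\<in>mpolys m. \<exists>h\<in>mpolys m. \<forall>y\<in>topspace ?X.
      meval h (s y) \<noteq> 0 \<and> u y = meval p (s y) / meval h (s y)"
    if u: "u \<in> regular quotient" for u
  proof -
    from u obtain p k where p: "p \<in> mpolys n"
        "\<And>x. x \<in> tuples \<Longrightarrow> u (q x) = meval p x / meval (discrim n) x ^ k"
      by (auto simp: geometric_quotient_def basic_open_variety_def)
    have "(\<lambda>t. meval p (\<lambda>i. \<psi> t i)) \<in> poly_funs m" "(\<lambda>t. meval (discrim n) (\<lambda>i. \<psi> t i) ^ k) \<in> poly_funs m"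
      using function_ring_meval[where R = "poly_funs m" and u = "\<lambda>i t. \<psi> t i", OF function_ring_poly_funs _ \<psi>]
        function_ring_power[OF function_ring_poly_funs] p(1) mpolys_discrim by blast+
    then obtain p' h where p': "p' \<in> mpolys m" "\<And>t. meval p (\<psi> t) = meval p' t"
      and h: "h \<in> mpolys m" "\<And>t. meval (discrim n) (\<psi> t) ^ k = meval h t"
      by (auto simp: poly_funs_def fun_eq_iff image_iff)
    show ?thesis
    proof (rule bexI[OF bexI[OF ballI h(1)] p'(1)])
      fix y assume "y \<in> topspace ?X"
      then have "\<exists>t. \<psi> t \<in> tuples \<and> q (\<psi> t) = y" using surj top by simp
      then have sy: "\<psi> (s y) \<in> tuples" "q (\<psi> (s y)) = y"
        unfolding s_def using someI_ex[of "\<lambda>t. \<psi> t \<in> tuples \<and> q (\<psi> t) = y"] by blast+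
      have "meval h (s y) \<noteq> 0"
        using sy(1) unfolding h(2)[symmetric] by (simp add: basic_open_def)
      moreover have "u y = meval p' (s y) / meval h (s y)"
        using p(2)[OF sy(1)] unfolding sy(2) p'(2) h(2) .
      ultimately show "meval h (s y) \<noteq> 0 \<and> u y = meval p' (s y) / meval h (s y)" ..
    qed
  qed
  show ?thesis
    by (rule krull_dim_le[OF function_ring_quotient closed sep rational])
qed

end

section \<open>Tuples modulo permutations and affine substitutions\<close>

lemma basic_open_discrim_affine:
  fixes x :: "nat \<Rightarrow> 'a::field"
  assumes "x \<in> basic_open n (discrim n)" "c \<noteq> 0"
  shows "(\<lambda>i\<in>{1..n}. c * x i + c') \<in> basic_open n (discrim n)"
proof -
  have "inj_on x {1..n}" using assms(1) unfolding basic_open_discrim by blast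
  then have "inj_on (\<lambda>i\<in>{1..n}. c * x i + c') {1..n}"
    using assms(2) by (intro inj_onI) (simp add: inj_on_eq_iff del: atLeastAtMost_iff)
  then show ?thesis
    by (simp add: basic_open_discrim affine_points_def)
qed

lemma slice_quotient_theta: "slice_quotient n (theta n :: (nat \<Rightarrow> 'a::field_char_0) \<Rightarrow> 'a set) (\<lambda>x. x)"
proof
  fix x y :: "nat \<Rightarrow> 'a"
  assume "x \<in> basic_open n (discrim n)" "y \<in> basic_open n (discrim n)"
  then show "theta n x = theta n y \<longleftrightarrow> (\<exists>\<sigma>. \<sigma> permutes {1..n} \<and> y = x \<circ> \<sigma>)"
    by (rule theta_eq_iff)
qed (simp_all only: regular_coordinate)

text \<open>The representative of a tuple, up to affine substitutions, with first entries \<open>0\<close> and \<open>1\<close>.\<close>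

definition normalize_tuple :: "nat \<Rightarrow> (nat \<Rightarrow> 'a::field) \<Rightarrow> nat \<Rightarrow> 'a"
  where "normalize_tuple n x = (\<lambda>i\<in>{1..n}. (x i - x 1) / (x 2 - x 1))"

lemma basic_open_discrim_distinct:
  assumes "x \<in> basic_open n (discrim n)" "i \<in> {1..n}" "j \<in> {1..n}" "i \<noteq> j"
  shows "x i \<noteq> (x j :: 'a::idom)"
  using assms unfolding basic_open_discrim inj_on_def by blast

lemma normalize_tuple_affine:
  fixes x y :: "nat \<Rightarrow> 'a::field"
  assumes "n \<ge> 2" "c \<noteq> 0" "\<And>i. i \<in> {1..n} \<Longrightarrow> y i = c * x i + c'"
  shows "normalize_tuple n y = normalize_tuple n x"
proof -
  have "y 1 = c * x 1 + c'" "y 2 = c * x 2 + c'" using assms by auto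
  moreover have "(c * u + c' - (c * v + c')) / (c * w + c' - (c * v + c')) = (u - v) / (w - v)" for u v w
    using assms(2) by (simp add: right_diff_distrib[symmetric])
  ultimately show ?thesis
    using assms(3) by (auto simp: normalize_tuple_def restrict_def fun_eq_iff)
qed

lemma normalize_tuple_eq_imp_affine:
  fixes x y :: "nat \<Rightarrow> 'a::field"
  assumes "n \<ge> 2" "x \<in> basic_open n (discrim n)" "y \<in> basic_open n (discrim n)"
    and "normalize_tuple n y = normalize_tuple n x"
  shows "\<exists>c c'. c \<noteq> 0 \<and> (\<forall>i\<in>{1..n}. y i = c * x i + c')"
proof -
  have x: "x 2 - x 1 \<noteq> 0" and y: "y 2 - y 1 \<noteq> 0"
    using basic_open_discrim_distinct[of _ n 2 1] assms by auto
  define c where "c = (y 2 - y 1) / (x 2 - x 1)"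
  have "y i = c * x i + (y 1 - c * x 1)" if i: "i \<in> {1..n}" for i
  proof -
    have "(y i - y 1) / (y 2 - y 1) = (x i - x 1) / (x 2 - x 1)"
      using fun_cong[OF assms(4), of i] i by (simp add: normalize_tuple_def)
    then have "y i - y 1 = c * (x i - x 1)"
      using x y by (simp add: c_def field_simps)
    then show ?thesis by (simp add: algebra_simps)
  qed
  moreover have "c \<noteq> 0" using x y by (simp add: c_def)
  ultimately show ?thesis by blast
qed

lemma normalize_tuple_as_affine:
  assumes "i \<in> {1..n}"
  shows "normalize_tuple n x i = (1 / (x 2 - x 1)) * x i + (- x 1 / (x 2 - x 1))"
  using assms by (simp add: normalize_tuple_def diff_divide_distrib)

lemma normalize_tuple_in:
  fixes x :: "nat \<Rightarrow> 'a::field"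
  assumes "n \<ge> 2" "x \<in> basic_open n (discrim n)"
  shows "normalize_tuple n x \<in> basic_open n (discrim n)"
proof -
  have d: "x 2 - x 1 \<noteq> 0" using basic_open_discrim_distinct[of x n 2 1] assms by auto
  have "normalize_tuple n x = (\<lambda>i\<in>{1..n}. (1 / (x 2 - x 1)) * x i + (- x 1 / (x 2 - x 1)))"
    by (rule extensionalityI[of _ "{1..n}"])
       (auto simp: normalize_tuple_as_affine, simp add: normalize_tuple_def)
  also have "\<dots> \<in> basic_open n (discrim n)"
    using d by (intro basic_open_discrim_affine[OF assms(2)]) simp
  finally show ?thesis .
qed

text \<open>
  Two tuples have equivalent sets of entries iff they agree up to a permutation and an affine
  substitution. The slice takes care of the substitution, whose coefficients are recovered from the
  first two entries.
\<close>

lemma slice_quotient_poly_class: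
  assumes n: "n \<ge> 2"
  shows "slice_quotient n (poly_class \<circ> theta n) (normalize_tuple n :: _ \<Rightarrow> nat \<Rightarrow> 'a::{alg_closed_field,field_char_0})"
proof
  fix x :: "nat \<Rightarrow> 'a" assume x: "x \<in> basic_open n (discrim n)"
  show "normalize_tuple n x \<in> basic_open n (discrim n)"
    by (rule normalize_tuple_in[OF n x])
  fix \<sigma> assume \<sigma>: "\<sigma> permutes {1..n}"
  have d: "x 2 - x 1 \<noteq> 0" using basic_open_discrim_distinct[OF x, of 2 1] n by auto
  show "normalize_tuple n (normalize_tuple n x \<circ> \<sigma>) = normalize_tuple n (x \<circ> \<sigma>)"
  proof (rule normalize_tuple_affine[OF n])
    show "1 / (x 2 - x 1) \<noteq> 0" using d by simp
    show "(normalize_tuple n x \<circ> \<sigma>) i = 1 / (x 2 - x 1) * (x \<circ> \<sigma>) i + (- x 1 / (x 2 - x 1))"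
      if "i \<in> {1..n}" for i
    proof -
      have "\<sigma> i \<in> {1..n}" using that permutes_in_image[OF \<sigma>] by blast
      then show ?thesis unfolding comp_def by (rule normalize_tuple_as_affine)
    qed
  qed
next
  fix i assume i: "i \<in> {1..n}"
  have ring: "function_ring (regular (basic_open_variety n (discrim n :: 'a mpoly)))"
    by (rule function_ring_regular[OF mpolys_discrim])
  have 12: "1 \<in> {1..n}" "2 \<in> {1..n}" using n by auto
  have "(\<lambda>x :: nat \<Rightarrow> 'a. (x i - x 1) * (1 / (x 2 - x 1))) \<in> regular (basic_open_variety n (discrim n))"
    by (intro function_ring_mult[OF ring] function_ring_diff[OF ring] regular_coordinate
        regular_inverse_diff i 12) simp
  then show "(\<lambda>x :: nat \<Rightarrow> 'a. normalize_tuple n x i) \<in> regular (basic_open_variety n (discrim n))"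
    using i by (simp add: normalize_tuple_def)
next
  fix x y :: "nat \<Rightarrow> 'a"
  assume x: "x \<in> basic_open n (discrim n)" and y: "y \<in> basic_open n (discrim n)"
  have "theta n x \<in> nsets n" using x theta_image by blast
  then have "(poly_class \<circ> theta n) x = (poly_class \<circ> theta n) y \<longleftrightarrow>
      (\<exists>c c'. c \<noteq> 0 \<and> theta n y = (\<lambda>z. c * z + c') ` theta n x)"
    using poly_class_eq_iff[OF _ n] by simp
  also have "\<dots> \<longleftrightarrow> (\<exists>\<sigma>. \<sigma> permutes {1..n} \<and> normalize_tuple n y = normalize_tuple n (x \<circ> \<sigma>))"
  proof
    assume "\<exists>c c'. c \<noteq> 0 \<and> theta n y = (\<lambda>z. c * z + c') ` theta n x"
    then obtain c c' where c: "c \<noteq> 0" "theta n y = (\<lambda>z. c * z + c') ` theta n x" by blast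
    define w where "w = (\<lambda>i\<in>{1..n}. c * x i + c')"
    have "w \<in> basic_open n (discrim n)"
      unfolding w_def by (rule basic_open_discrim_affine[OF x c(1)])
    moreover have "theta n w = theta n y"
      unfolding c(2) by (simp add: theta_def w_def image_image)
    ultimately obtain \<sigma> where \<sigma>: "\<sigma> permutes {1..n}" "y = w \<circ> \<sigma>"
      using theta_eq_iff y by blast
    have "normalize_tuple n y = normalize_tuple n (x \<circ> \<sigma>)"
    proof (rule normalize_tuple_affine[OF n c(1)])
      show "y i = c * (x \<circ> \<sigma>) i + c'" if "i \<in> {1..n}" for i
      proof -
        have "\<sigma> i \<in> {1..n}" using that permutes_in_image[OF \<sigma>(1)] by blast
        then show ?thesis by (simp add: \<sigma>(2) w_def)
      qed
    qed
    with \<sigma>(1) show "\<exists>\<sigma>. \<sigma> permutes {1..n} \<and> normalize_tuple n y = normalize_tuple n (x \<circ> \<sigma>)" by blast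
  next
    assume "\<exists>\<sigma>. \<sigma> permutes {1..n} \<and> normalize_tuple n y = normalize_tuple n (x \<circ> \<sigma>)"
    then obtain \<sigma> where \<sigma>: "\<sigma> permutes {1..n}" "normalize_tuple n y = normalize_tuple n (x \<circ> \<sigma>)" by blast
    obtain c c' where c: "c \<noteq> 0" "\<forall>i\<in>{1..n}. y i = c * (x \<circ> \<sigma>) i + c'"
      using normalize_tuple_eq_imp_affine[OF n basic_open_permute[OF x \<sigma>(1)] y \<sigma>(2)] by blast
    have "theta n y = (\<lambda>i. c * (x \<circ> \<sigma>) i + c') ` {1..n}"
      unfolding theta_def using c(2) by (intro image_cong) auto
    also have "\<dots> = (\<lambda>z. c * z + c') ` x ` \<sigma> ` {1..n}"
      by (simp add: image_image)
    finally have "theta n y = (\<lambda>z. c * z + c') ` theta n x"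
      unfolding permutes_image[OF \<sigma>(1)] theta_def .
    with c(1) show "\<exists>c c'. c \<noteq> 0 \<and> theta n y = (\<lambda>z. c * z + c') ` theta n x" by blast
  qed
  finally show "(poly_class \<circ> theta n) x = (poly_class \<circ> theta n) y \<longleftrightarrow>
    (\<exists>\<sigma>. \<sigma> permutes {1..n} \<and> normalize_tuple n y = normalize_tuple n (x \<circ> \<sigma>))" .
qed

section \<open>Polynomial classes are surfaces\<close>

lemma poly_class_eq_affine_images:
  fixes B :: "'a::{alg_closed_field,field_char_0} set"
  assumes "B \<in> nsets n" "n \<ge> 2"
  shows "poly_class B = {(\<lambda>z. c * z + c') ` B | c c'. c \<noteq> 0}"
  unfolding poly_class_def poly_equiv_iff_linear[OF assms]
  by (intro Collect_cong ex_cong1 conj_commute)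

text \<open>
  Let the tuple \<open>b\<close> enumerate \<open>B\<close>. The class of \<open>B\<close> is the image of the plane of tuples \<open>cb + c'\<close>
  (with \<open>c\<close> nonzero), cut out by the linear equations in \<open>W 2\<close> that compare ratios of differences.
  The chain consists of the point \<open>b\<close>, the line of translates \<open>b + c'\<close>, and the plane.
\<close>

lemma poly_class_surface:
  fixes B :: "'a::{alg_closed_field,field_char_0} set"
  assumes B: "B \<in> nsets n" and n: "n \<ge> 2"
  shows "closedin (zariski (P_variety n :: ('a set, 'a) variety)) (poly_class B) \<and>
    krull_dim (subtopology (zariski (P_variety n :: ('a set, 'a) variety)) (poly_class B)) = 2"
proof -
  interpret slice_quotient n "theta n :: (nat \<Rightarrow> 'a) \<Rightarrow> 'a set" "\<lambda>x. x"
    by (rule slice_quotient_theta)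
  have "B \<in> theta n ` tuples" using B by (simp only: theta_image)
  then obtain b where b: "b \<in> tuples" "theta n b = B" by blast
  have b12: "b 2 \<noteq> b 1" using basic_open_discrim_distinct[OF b(1), of 2 1] n by auto
  have 12: "1 \<in> {1..n}" "2 \<in> {1..n}" using n by auto
  define W :: "nat \<Rightarrow> (nat \<Rightarrow> 'a) set" where "W k =
     (if k = 0 then {x\<in>tuples. \<forall>i\<in>{1..n}. x i - b i = 0}
      else if k = Suc 0 then {x\<in>tuples. \<forall>i\<in>{1..n}. (x i - x 1) - (b i - b 1) = 0}
      else {x\<in>tuples. \<forall>i\<in>{1..n}. (b 2 - b 1) * (x i - x 1) - (b i - b 1) * (x 2 - x 1) = 0})" for k
  have W0: "x \<in> W 0 \<longleftrightarrow> x \<in> tuples \<and> (\<forall>i\<in>{1..n}. x i = b i)"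
    and W1: "x \<in> W (Suc 0) \<longleftrightarrow> x \<in> tuples \<and> (\<forall>i\<in>{1..n}. x i - x 1 = b i - b 1)"
    and W2: "x \<in> W 2 \<longleftrightarrow> x \<in> tuples \<and> (\<forall>i\<in>{1..n}. (b 2 - b 1) * (x i - x 1) = (b i - b 1) * (x 2 - x 1))" for x
    by (simp_all only: W_def right_minus_eq) simp_all
  have cases: "k = 0 \<or> k = Suc 0 \<or> k = 2" if "k \<le> 2" for k :: nat using that by auto
  have closed: "closedin (zariski tuple_variety) (W k)" for k
    unfolding W_def
    by (simp only: split: if_split, intro conjI impI; intro closedin_regular_common_zeros
        function_ring_diff[OF function_ring_tuples] function_ring_mult[OF function_ring_tuples]
        function_ring_const[OF function_ring_tuples] regular_coordinate 12; assumption)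
  have sub: "W k \<subseteq> tuples" for k by (auto simp: W_def)
  have bW: "b \<in> W k" if "k \<le> 2" for k
    using cases[OF that] b(1) by (auto simp: W0 W1 W2)
  have line: "(\<lambda>i. x i + t * (y i - x i)) \<in> W k"
    if xy: "x \<in> W k" "y \<in> W k" "(\<lambda>i. x i + t * (y i - x i)) \<in> tuples" and k: "k \<le> 2" for x y t k
  proof -
    consider "k = 0" | "k = Suc 0" | "k = 2" using cases[OF k] by blast
    then show ?thesis
    proof cases
      case 1
      then show ?thesis using xy by (simp add: W0)
    next
      case 2
      have "x i + t * (y i - x i) - (x 1 + t * (y 1 - x 1)) = b i - b 1" if "i \<in> {1..n}" for i
      proof -
        have "x i - x 1 = b i - b 1" "y i - y 1 = b i - b 1" using xy that by (auto simp: 2 W1)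
        then show ?thesis by algebra
      qed
      then show ?thesis using xy(3) by (simp add: 2 W1)
    next
      case 3
      have "(b 2 - b 1) * (x i + t * (y i - x i) - (x 1 + t * (y 1 - x 1))) =
          (b i - b 1) * (x 2 + t * (y 2 - x 2) - (x 1 + t * (y 1 - x 1)))" if "i \<in> {1..n}" for i
      proof -
        have "(b 2 - b 1) * (x i - x 1) = (b i - b 1) * (x 2 - x 1)"
          "(b 2 - b 1) * (y i - y 1) = (b i - b 1) * (y 2 - y 1)" using xy that by (auto simp: 3 W2)
        then show ?thesis by algebra
      qed
      then show ?thesis using xy(3) by (simp add: 3 W2)
    qed
  qed
  have irr: "irreducible_space (subtopology (zariski tuple_variety) (W k))" if k: "k \<le> 2" for k
    using line[OF _ _ _ k] bW[OF k] by (intro irreducible_space_line_closed[OF mpolys_discrim sub]) auto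
  have affine: "(\<lambda>i\<in>{1..n}. c * b i + c') \<in> tuples" if "c \<noteq> 0" for c c'
    by (rule basic_open_discrim_affine[OF b(1) that])
  have chain: "W k \<subset> W (Suc k)" if "k < 2" for k
  proof -
    consider "k = 0" | "k = Suc 0" using \<open>k < 2\<close> by fastforce
    then show ?thesis
    proof cases
      case 1
      have "W 0 \<subseteq> W (Suc 0)" using 12 by (auto simp: W0 W1)
      moreover have "(\<lambda>i\<in>{1..n}. 1 * b i + 1) \<in> W (Suc 0) - W 0"
        using affine[of 1 1] 12 by (auto simp: W0 W1)
      ultimately show ?thesis using 1 by auto
    next
      case 2
      have "W (Suc 0) \<subseteq> W 2"
      proof
        fix x assume x: "x \<in> W (Suc 0)"
        have "(b 2 - b 1) * (x i - x 1) = (b i - b 1) * (x 2 - x 1)" if "i \<in> {1..n}" for i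
        proof -
          have "x i - x 1 = b i - b 1" "x 2 - x 1 = b 2 - b 1" using x that 12 by (auto simp: W1)
          then show ?thesis by (simp add: mult.commute)
        qed
        then show "x \<in> W 2" using x by (simp add: W1 W2)
      qed
      moreover have "(\<lambda>i\<in>{1..n}. 2 * b i + 0) \<in> W 2"
        using affine[of 2 0] 12 by (auto simp: W2 algebra_simps)
      moreover have "(\<lambda>i\<in>{1..n}. 2 * b i + 0) \<notin> W (Suc 0)"
      proof
        assume "(\<lambda>i\<in>{1..n}. 2 * b i + 0) \<in> W (Suc 0)"
        then have "(\<lambda>i\<in>{1..n}. 2 * b i + 0) 2 - (\<lambda>i\<in>{1..n}. 2 * b i + 0) 1 = b 2 - b 1"
          using 12(2) unfolding W1 by blast
        then have "2 * b 2 - 2 * b 1 = b 2 - b 1"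
          unfolding restrict_apply'[OF 12(1)] restrict_apply'[OF 12(2)] by simp
        then have "b 2 = b 1" by algebra
        with b12 show False by simp
      qed
      ultimately show ?thesis using 2 by (auto simp: numeral_2_eq_2)
    qed
  qed
  have class_eq: "poly_class B = theta n ` W 2"
  proof (intro equalityI subsetI)
    fix A assume "A \<in> poly_class B"
    then obtain c c' where c: "c \<noteq> 0" "A = (\<lambda>z. c * z + c') ` B"
      unfolding poly_class_eq_affine_images[OF B n] by blast
    have "(\<lambda>i\<in>{1..n}. c * b i + c') \<in> W 2"
      using affine[OF c(1)] 12 by (auto simp: W2 algebra_simps)
    moreover have "theta n (\<lambda>i\<in>{1..n}. c * b i + c') = A"
      by (simp add: c(2) b(2)[symmetric] theta_def image_image)
    ultimately show "A \<in> theta n ` W 2" by blast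
  next
    fix A assume "A \<in> theta n ` W 2"
    then obtain x where x: "x \<in> W 2" "A = theta n x" by blast
    define c where "c = (x 2 - x 1) / (b 2 - b 1)"
    have x12: "x 2 \<noteq> x 1" using basic_open_discrim_distinct[of x n 2 1] x(1) sub n by auto
    have xi: "x i = c * b i + (x 1 - c * b 1)" if "i \<in> {1..n}" for i
    proof -
      have "(b 2 - b 1) * (x i - x 1) = (b i - b 1) * (x 2 - x 1)" using x(1) that by (simp add: W2)
      then have "x i - x 1 = c * (b i - b 1)" using b12 by (simp add: c_def field_simps)
      then show ?thesis by (simp add: algebra_simps)
    qed
    have "A = (\<lambda>i. c * b i + (x 1 - c * b 1)) ` {1..n}"
      unfolding x(2) theta_def by (intro image_cong refl xi)
    then have "A = (\<lambda>z. c * z + (x 1 - c * b 1)) ` B"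
      unfolding b(2)[symmetric] theta_def image_image .
    moreover have "c \<noteq> 0" using x12 b12 by (simp add: c_def)
    ultimately show "A \<in> poly_class B"
      unfolding poly_class_eq_affine_images[OF B n] by blast
  qed
  have "ereal (real 2) \<le> krull_dim (subtopology (zariski quotient) (poly_class B))"
    by (rule krull_dim_ge[where W = W]) (use closed irr chain class_eq in auto)
  moreover have "krull_dim (subtopology (zariski quotient) (poly_class B)) \<le> ereal (real 2)"
  proof (rule krull_dim_le_parametrization)
    let ?\<psi> = "\<lambda>t :: nat \<Rightarrow> 'a. \<lambda>i\<in>{1..n}. t 1 * b i + t 2"
    show "(\<lambda>t. ?\<psi> t i) \<in> poly_funs 2" if i: "i \<in> {1..n}" for i
    proof -
      have "(\<lambda>t. t 1 * b i + t 2) \<in> poly_funs 2"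
        by (intro function_ring_add[OF function_ring_poly_funs] function_ring_mult[OF function_ring_poly_funs]
            function_ring_const[OF function_ring_poly_funs] poly_funs_coordinate) auto
      then show ?thesis using i by simp
    qed
    fix A assume "A \<in> poly_class B"
    then obtain c c' where c: "c \<noteq> 0" "A = (\<lambda>z. c * z + c') ` B"
      unfolding poly_class_eq_affine_images[OF B n] by blast
    have "theta n (\<lambda>i\<in>{1..n}. c * b i + c') = A"
      by (simp add: c(2) b(2)[symmetric] theta_def image_image)
    then show "\<exists>t. ?\<psi> t \<in> tuples \<and> theta n (?\<psi> t) = A"
      using affine[OF c(1), of c'] by (intro exI[of _ "\<lambda>j. if j = 1 then c else c'"]) simp
  qed
  moreover have "closedin (zariski quotient) (poly_class B)"
    unfolding class_eq by (rule closedin_q_image[OF closed]) simp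
  ultimately show ?thesis by (simp add: P_variety_def antisym)
qed

section \<open>The dimension of the variety of polynomial classes\<close>

lemma Sigma_variety_as_quotient_of_tuples:
  "Sigma_variety n = geometric_quotient (basic_open_variety n (discrim n)) (poly_class \<circ> theta n)"
  by (simp add: Sigma_variety_def P_variety_def geometric_quotient_geometric_quotient)

text \<open>
  The \<open>k\<close>-th set of the chain leaves \<open>k\<close> coordinates of the slice free, namely those with indices
  \<open>3, \<dots>, k + 2\<close>, and fixes the others at the distinct values \<open>0, 1, 2, \<dots>\<close>, that is,
  \<open>x\<^sub>i = i - 1\<close>; the first two of these values are those prescribed by the slice.
\<close>

lemma krull_dim_Sigma_variety:
  assumes n: "n \<ge> 2"
  shows "krull_dim (zariski (Sigma_variety n :: ('a::{alg_closed_field,field_char_0} set set, 'a) variety)) =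
    ereal (real (n - 2))"
proof -
  interpret slice_quotient n "poly_class \<circ> theta n" "normalize_tuple n :: _ \<Rightarrow> nat \<Rightarrow> 'a"
    by (rule slice_quotient_poly_class[OF n])
  let ?q = "poly_class \<circ> theta n :: (nat \<Rightarrow> 'a) \<Rightarrow> 'a set set"
  have whole: "subtopology (zariski quotient) (?q ` tuples) = zariski quotient"
    by (metis subtopology_topspace topspace_quotient)
  define W :: "nat \<Rightarrow> (nat \<Rightarrow> 'a) set" where
    "W k = {x\<in>tuples. \<forall>i\<in>{i\<in>{1..n}. i \<le> 2 \<or> 2 + k < i}. x i - (of_nat i - 1) = 0}" for k
  have W: "x \<in> W k \<longleftrightarrow> x \<in> tuples \<and> (\<forall>i\<in>{1..n}. i \<le> 2 \<or> 2 + k < i \<longrightarrow> x i = of_nat i - 1)" for x k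
    unfolding W_def right_minus_eq by blast
  define a :: "nat \<Rightarrow> 'a" where "a = (\<lambda>i\<in>{1..n}. of_nat i - 1)"
  have aW: "a \<in> W k" for k
    by (auto simp: W a_def basic_open_discrim affine_points_def inj_on_def)
  have closed: "closedin (zariski tuple_variety) (W k)" for k
    unfolding W_def by (intro closedin_regular_common_zeros function_ring_diff[OF function_ring_tuples]
        function_ring_const[OF function_ring_tuples] regular_coordinate) blast
  have irr: "irreducible_space (subtopology (zariski tuple_variety) (W k))" for k
  proof (rule irreducible_space_line_closed[OF mpolys_discrim])
    show "W k \<subseteq> tuples" "W k \<noteq> {}" using aW by (auto simp: W_def)
  qed (auto simp: W)
  have fixed: "normalize_tuple n x = x" if "x \<in> W k" for x k
  proof -
    have x: "x \<in> tuples" "x 1 = 0" "x 2 = 1" using that n by (auto simp: W)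
    show ?thesis
      by (rule extensionalityI[of _ "{1..n}"])
         (use x in \<open>auto simp: normalize_tuple_def basic_open_def affine_points_def PiE_def\<close>)
  qed
  have chain: "W k \<subset> W (Suc k)" if "k < n - 2" for k
  proof -
    have "W k \<subseteq> W (Suc k)" by (auto simp: W)
    \<comment> \<open>\<open>n\<close> differs from all values \<open>i - 1\<close> with \<open>i \<le> n\<close>\<close>
    moreover have "a(3 + k := of_nat n) \<in> W (Suc k)"
    proof -
      have "a(3 + k := of_nat n) \<in> tuples"
        using that by (auto simp: a_def basic_open_discrim affine_points_def inj_on_def of_nat_diff
            PiE_def extensional_def algebra_simps simp flip: of_nat_Suc)
      then show ?thesis using aW by (auto simp: W)
    qed
    moreover have "a(3 + k := of_nat n) \<notin> W k"
    proof
      assume "a(3 + k := of_nat n) \<in> W k"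
      then have "(of_nat n :: 'a) = of_nat (3 + k) - 1" using that by (auto simp: W)
      then have "(of_nat (n + 1) :: 'a) = of_nat (3 + k)" by (simp add: algebra_simps)
      then have "n + 1 = 3 + k" unfolding of_nat_eq_iff .
      then show False using that by simp
    qed
    ultimately show ?thesis by blast
  qed
  have "ereal (real (n - 2)) \<le> krull_dim (subtopology (zariski quotient) (?q ` tuples))"
    by (rule krull_dim_ge[where W = W]) (use closed irr fixed chain in \<open>auto simp: W_def\<close>)
  moreover have "krull_dim (subtopology (zariski quotient) (?q ` tuples)) \<le> ereal (real (n - 2))"
  proof (rule krull_dim_le_parametrization)
    let ?\<psi> = "\<lambda>t. \<lambda>i\<in>{1..n}. if i = 1 then 0 else if i = 2 then 1 else t (i - 2)"
    show "(\<lambda>t. ?\<psi> t i) \<in> poly_funs (n - 2)" if i: "i \<in> {1..n}" for i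
    proof -
      consider "i = 1" | "i = 2" | "i - 2 \<in> {1..n - 2}" "i \<noteq> 1" "i \<noteq> 2" using i by fastforce
      then show ?thesis
        using i by cases (simp_all add: function_ring_const[OF function_ring_poly_funs]
            poly_funs_coordinate[of "i - 2"])
    qed
    fix y assume "y \<in> ?q ` tuples"
    then obtain x where x: "x \<in> tuples" "y = ?q x" by blast
    have d: "x 2 - x 1 \<noteq> 0" using basic_open_discrim_distinct[OF x(1), of 2 1] n by auto
    have "?\<psi> (\<lambda>j. normalize_tuple n x (j + 2)) i = normalize_tuple n x i" for i
    proof -
      consider "i \<notin> {1..n}" "i \<noteq> 1" "i \<noteq> 2" | "i = 1" | "i = 2" | "i \<in> {1..n}" "i - 2 + 2 = i" "i \<noteq> 1" "i \<noteq> 2"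
        using n by fastforce
      then show ?thesis
      proof cases
        case 1
        then show ?thesis by (simp only: normalize_tuple_def restrict_def if_False)
      qed (use d n in \<open>simp_all add: normalize_tuple_def\<close>)
    qed
    then have "?\<psi> (\<lambda>j. normalize_tuple n x (j + 2)) = normalize_tuple n x" by (rule ext)
    then show "\<exists>t. ?\<psi> t \<in> tuples \<and> ?q (?\<psi> t) = y"
      using N_in[OF x(1)] q_N[OF x(1)] x(2) by (intro exI[of _ "\<lambda>j. normalize_tuple n x (j + 2)"]) simp
  qed
  ultimately show ?thesis
    unfolding Sigma_variety_as_quotient_of_tuples whole by (rule antisym[rotated])
qed

theorem corollary16:
  fixes n :: nat
  assumes "n \<ge> 3"
  shows "(\<forall>B\<in>nsets n.
            subvariety (P_variety n :: ('a::{alg_closed_field,field_char_0} set, 'a) variety) (poly_class B) \<and>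
            subvariety_dim (P_variety n :: ('a set, 'a) variety) (poly_class B) = 2) \<and>
         variety_dim (Sigma_variety n :: ('a set set, 'a) variety) = ereal (real n - 2)"
proof -
  have n: "n \<ge> 2" using assms by simp
  then have "real (n - 2) = real n - 2" by simp
  then show ?thesis
    unfolding subvariety_def subvariety_dim_def variety_dim_def
    using poly_class_surface[where ?'a = 'a, OF _ n] krull_dim_Sigma_variety[where ?'a = 'a, OF n] by simp
qed

end
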